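(* Let $\mathcal H=\mathbb R^d$ with $d\ge1$, let $X_1,\dots,X_m$ be non-empty closed convex subsets of $\mathcal H$, let $X=\bigcap_{i=1}^mX_i$, and consider the problem $$(P)\qquad \min_{x\in X} F(x),\qquad F(x)=\int f(s,x)\,d\mu(s).$$ Assume the following. (1) $(\lambda_n)_{n\in\mathbb N}$ is a sequence of positive reals with $\sum_n\lambda_n=+\infty$ and $\sum_n\lambda_n^2<\infty$; the random variables $(\xi_n)_{n\ge1}$ are independent and identically distributed with distribution $\mu$. (2) $X$ is non-empty and the sets $X_1,\dots,X_m$ are boundedly linearly regular: for every $M>0$ there exists $\kappa'_M>0$ such that $\max_{1\le i\le m}d(x,X_i)\ge\kappa'_M\,d(x,X)$ for every $x$ with $\|x\|\le M$. (3) $f:E\times\mathcal H\to\mathbb R$ is a normal convex integrand and $f(\cdot,x)$ is $\mu$-integrable for each $x\in\mathcal H$. (4) A solution to $(P)$ exists and every solution $x^\star$ satisfies $|\partial f(\cdot,x^\star)|\in L^2(E,\mathbb R,\mu)$. (5) There exist an integer $p\ge1$ and a solution $x^\star_p$ to $(P)$ such that $|\partial f(\cdot,x^\star_p)|\in L^{2p}(E,\mathbb R,\mu)$. (6) For this $p$, there exists $C\in L^2(E,\mathbb R_+,\mu)$ such that for any $x\in\mathcal H$, $\|\partial f_0(s,x)\|\le C(s)(1+\|x\|^p)$ for $\mu$-a.e. $s$. Let $(I_n)_{n\ge1}$ be a sequence of independent and identically distributed random variables on $\{0,1,\dots,m\}$, independent of $(\xi_n)$, with $p_i=\mathbb P(I_n=i)>0$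 for all $i\in\{0,1,\dots,m\}$, and let $\lambda_n/\lambda_{n+1}\to1$ as $n\to\infty$. Let $x_0\in\mathcal H$ be fixed and define, for $n\in\mathbb N$, $$x_{n+1}=\begin{cases}\mathrm{prox}_{\lambda_nf(\xi_{n+1},\cdot)}(x_n)&\text{if }I_{n+1}=0,\\ \mathrm{proj}_{X_{I_{n+1}}}(x_n)&\text{otherwise,}\end{cases}$$ with weighted averages $\overline x_n=\sum_{k=1}^n\lambda_kx_k/\sum_{k=1}^n\lambda_k$. Then, almost surely, $(\overline x_n)$ converges to a solution to $(P)$.
   Context: $(E,\mathcal E,\mu)$ is a complete probability space, $\mathcal B(\mathcal H)$ is the Borel $\sigma$-algebra of $\mathcal H=\mathbb R^d$, and $(\xi_n)$, $(I_n)$ are random variables on a probability space $(\Omega,\mathcal F,\mathbb P)$ with values in $E$ and $\{0,1,\dots,m\}$ respectively. $f:E\times\mathcal H\to\mathbb R$ is a normal convex integrand if it is $\mathcal E\otimes\mathcal B(\mathcal H)$-measurable and $f(s,\cdot)$ is lower semicontinuous, proper and convex for each $s\in E$. $\partial f(s,x)=\{u\in\mathcal H:\forall y\in\mathcal H,\ f(s,y)\ge f(s,x)+\langle u,y-x\rangle\}$ is the subdifferential in the second variable, and $\partial f_0(s,x)$ is the element of $\partial f(s,x)$ with smallest norm. For a set $Q\subset\mathcal H$, $|Q|=\sup\{\|x\|:x\in Q\}$ and $d(x,Q)=\inf_{y\in Q}\|x-y\|$. $\mathrm{prox}_{\lambda g}(x)=\arg\min_{t\in\mathcal H}\ \lambda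 g(t)+\tfrac12\|t-x\|^2$ and $\mathrm{proj}_C$ is the projection onto a closed convex set $C$. *)

theory Defs
  imports "HOL-Probability.Probability"
begin

definition lower_semicontinuous :: "('a::topological_space \<Rightarrow> real) \<Rightarrow> bool" where
  "lower_semicontinuous g \<longleftrightarrow> (\<forall>x. \<forall>c<g x. \<forall>\<^sub>F y in nhds x. c < g y)"

text \<open>
  The integrand is real-valued, so properness (nowhere minus infinity, somewhere finite)
  holds by typing and is not a separate conjunct.
\<close>

definition normal_convex_integrand ::
    "'e measure \<Rightarrow> ('e \<Rightarrow> 'a::euclidean_space \<Rightarrow> real) \<Rightarrow> bool" where
  "normal_convex_integrand \<mu> f \<longleftrightarrow>
     (\<lambda>(s, x). f s x) \<in> borel_measurable (\<mu> \<Otimes>\<^sub>M borel) \<and>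
     (\<forall>s\<in>space \<mu>. lower_semicontinuous (f s) \<and> convex_on UNIV (f s))"

definition subdifferential :: "('a::real_inner \<Rightarrow> real) \<Rightarrow> 'a \<Rightarrow> 'a set" where
  "subdifferential g x = {u. \<forall>y. g y \<ge> g x + inner u (y - x)}"

definition min_norm_subgradient :: "('a::real_inner \<Rightarrow> real) \<Rightarrow> 'a \<Rightarrow> 'a" where
  "min_norm_subgradient g x = arg_min norm (\<lambda>u. u \<in> subdifferential g x)"

text \<open>
  The supremum is taken in the reals, so it is meaningful for non-empty bounded sets only.
  Subdifferentials of finite convex functions on a Euclidean space are of this kind.
\<close>

definition set_norm :: "'a::real_normed_vector set \<Rightarrow> real" where
  "set_norm Q = (SUP u\<in>Q. norm u)"

definition in_Lp :: "'e measure \<Rightarrow> nat \<Rightarrow> ('e \<Rightarrow> real) \<Rightarrow> bool" where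
  "in_Lp M q g \<longleftrightarrow> g \<in> borel_measurable M \<and> integrable M (\<lambda>s. \<bar>g s\<bar> ^ q)"

definition prox :: "real \<Rightarrow> ('a::real_inner \<Rightarrow> real) \<Rightarrow> 'a \<Rightarrow> 'a" where
  "prox l g x = arg_min (\<lambda>t. l * g t + (1 / 2) * (norm (t - x))\<^sup>2) (\<lambda>_. True)"

definition boundedly_linearly_regular ::
    "nat \<Rightarrow> (nat \<Rightarrow> 'a::euclidean_space set) \<Rightarrow> bool" where
  "boundedly_linearly_regular m X \<longleftrightarrow>
     (\<forall>M>0. \<exists>\<kappa>>0. \<forall>x. norm x \<le> M \<longrightarrow>
        (MAX i\<in>{1..m}. infdist x (X i)) \<ge> \<kappa> * infdist x (\<Inter>i\<in>{1..m}. X i))"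

definition objective :: "'e measure \<Rightarrow> ('e \<Rightarrow> 'a \<Rightarrow> real) \<Rightarrow> 'a \<Rightarrow> real" where
  "objective \<mu> f x = (\<integral>s. f s x \<partial>\<mu>)"

definition is_solution ::
    "'e measure \<Rightarrow> ('e \<Rightarrow> 'a \<Rightarrow> real) \<Rightarrow> nat \<Rightarrow> (nat \<Rightarrow> 'a set) \<Rightarrow> 'a \<Rightarrow> bool" where
  "is_solution \<mu> f m X x \<longleftrightarrow> is_arg_min (objective \<mu> f) (\<lambda>y. y \<in> (\<Inter>i\<in>{1..m}. X i)) x"

primrec iterate ::
    "('e \<Rightarrow> 'a::euclidean_space \<Rightarrow> real) \<Rightarrow> (nat \<Rightarrow> 'a set) \<Rightarrow> (nat \<Rightarrow> real) \<Rightarrow>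
     (nat \<Rightarrow> 'w \<Rightarrow> 'e) \<Rightarrow> (nat \<Rightarrow> 'w \<Rightarrow> nat) \<Rightarrow> 'a \<Rightarrow> nat \<Rightarrow> 'w \<Rightarrow> 'a" where
  "iterate f X l \<xi> J x0 0 \<omega> = x0"
| "iterate f X l \<xi> J x0 (Suc n) \<omega> =
     (if J (Suc n) \<omega> = 0
      then prox (l n) (f (\<xi> (Suc n) \<omega>)) (iterate f X l \<xi> J x0 n \<omega>)
      else closest_point (X (J (Suc n) \<omega>)) (iterate f X l \<xi> J x0 n \<omega>))"

definition weighted_average :: "(nat \<Rightarrow> real) \<Rightarrow> (nat \<Rightarrow> 'a::real_vector) \<Rightarrow> nat \<Rightarrow> 'a" where
  "weighted_average l x n = (\<Sum>k=1..n. l k *\<^sub>R x k) /\<^sub>R (\<Sum>k=1..n. l k)"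

end

theory Submission
  imports Defs
begin

text \<open>
  Fix a solution \<open>z\<close> and follow \<open>(norm (x n - z))\<^sup>2\<close>. A proximal step from \<open>y\<close> decreases the squared
  distance by at least \<open>2 * (e y - l * f s z)\<close>, where \<open>e\<close> is \<open>l\<close> times the Moreau envelope of \<open>f s\<close>
  (\<open>prox_step_le\<close>), and a projection onto \<open>X i\<close> decreases it by \<open>(infdist y (X i))\<^sup>2\<close>
  (\<open>closest_point_step_le\<close>). What has to be shown is that the mean of these decreases over the noise is
  nonnegative up to terms of order \<open>l\<^sup>2 * (1 + (norm (y - z))\<^sup>2)\<close>.

  The obstacle is that the iterates are not feasible, so that the objective may be smaller at \<open>x n\<close>
  than at \<open>z\<close>. Near \<open>z\<close>, linear regularity and the Lipschitz property of the objective show that a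
  multiple of \<open>\<Sum>i. infdist y (X i)\<close> compensates for this, and a convex function with a local minimum
  at \<open>z\<close> has a global one there; hence this exact penalty works on the whole space (\<open>exact_penalty\<close>).
  The same passage from local to global is applied to the mean envelope, which is convex, lies below
  \<open>l\<close> times the objective, and is within \<open>O(l\<^sup>2)\<close> of it near \<open>z\<close> by the growth condition. Far away the
  error is \<open>O(l\<^sup>2 * norm (y - z))\<close>, whatever the exponent \<open>p\<close> of the growth
  condition (\<open>mean_envelope_penalty\<close>). The penalty has size \<open>l * infdist y (X i)\<close> and is absorbed
  by the squared distances gained by the projections, again up to \<open>O(l\<^sup>2)\<close> (\<open>mean_decrease\<close>).

  The Robbins--Siegmund theorem, derived here from an upcrossing inequality, now gives two facts
  almost surely: \<open>norm (x n - z)\<close> converges, and the mean decreases, made nonnegative by the penalty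
  and error terms, are summable. On a bounded
  trajectory the envelope may be replaced by the objective at a cost of \<open>O(l\<^sup>2)\<close>, so the penalised
  gap of \<open>x n\<close>, weighted by \<open>l n\<close>, is summable. By Jensen's inequality the gap of the averages tends to
  \<open>0\<close>, and every cluster point of the averages is a solution (\<open>cluster_point_is_solution\<close>). Finally, for
  solutions \<open>u\<close> and \<open>v\<close> the convergence of \<open>norm (x n - u)\<close> and \<open>norm (x n - v)\<close> makes
  \<open>inner (x n) (u - v)\<close> converge, which leaves only one cluster point (\<open>weighted_average_converges_in\<close>).
\<close>

section \<open>Subgradients and proximal steps of a finite convex function\<close>

text \<open>
  A hyperplane separating the point \<open>(x, g x)\<close> from the strict epigraph of \<open>g\<close> cannot be vertical,
  because \<open>g\<close> is finite everywhere; its slope is a subgradient.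
\<close>

lemma subdifferential_nonempty:
  fixes g :: "'a::euclidean_space \<Rightarrow> real"
  assumes "convex_on UNIV g"
  shows "subdifferential g x \<noteq> {}"
proof -
  let ?T = "{(y, r). g y < r}"
  have "convex ?T"
  proof (rule convexI, clarsimp)
    fix y r y' r' and u v :: real
    assume *: "g y < r" "g y' < r'" "0 \<le> u" "0 \<le> v" "u + v = 1"
    have "g (u *\<^sub>R y + v *\<^sub>R y') \<le> u * g y + v * g y'"
      using assms * by (auto simp: convex_on_def)
    also have "\<dots> < u * r + v * r'"
    proof (cases "u = 0")
      case True then show ?thesis using * by auto
    next
      case False
      then have "u * g y < u * r" using * by simp
      moreover have "v * g y' \<le> v * r'" using * by (simp add: mult_left_mono)
      ultimately show ?thesis by simp
    qed
    finally show "g (u *\<^sub>R y + v *\<^sub>R y') < u * r + v * r'" .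
  qed
  moreover have "?T \<noteq> {}" using gt_ex[of "g x"] by auto
  ultimately obtain w b where w: "w \<noteq> 0" "inner w (x, g x) \<le> b" "\<And>z. z \<in> ?T \<Longrightarrow> inner w z \<ge> b"
    using separating_hyperplane_sets[of "{(x, g x)}" ?T] by fastforce
  obtain a \<alpha> where wa: "w = (a, \<alpha>)" by (cases w)
  have sep: "inner a (y - x) + \<alpha> * (r - g x) \<ge> 0" if "g y < r" for y r
    using w(2) w(3)[of "(y, r)"] that by (auto simp: wa inner_diff_right algebra_simps)
  have "\<alpha> \<ge> 0" using sep[of x "g x + 1"] by simp
  moreover have "\<alpha> \<noteq> 0"
  proof
    assume "\<alpha> = 0"
    then have "inner a (- a) \<ge> 0" using sep[of "x - a" "g (x - a) + 1"] by simp
    then have "a = 0" using inner_ge_zero[of a] by simp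
    then show False using w(1) wa \<open>\<alpha> = 0\<close> by (simp add: zero_prod_def)
  qed
  ultimately have \<alpha>: "\<alpha> > 0" by simp
  have "g y \<ge> g x + inner (- a /\<^sub>R \<alpha>) (y - x)" for y
  proof (rule field_le_epsilon)
    fix e :: real assume "e > 0"
    then have "0 \<le> inner a (y - x) + \<alpha> * (g y + e - g x)" using sep[of y "g y + e"] by simp
    then have "0 \<le> (inner a (y - x) + \<alpha> * (g y + e - g x)) / \<alpha>" using \<alpha> by simp
    then show "g x + inner (- a /\<^sub>R \<alpha>) (y - x) \<le> g y + e"
      using \<alpha> by (simp add: field_simps)
  qed
  then show ?thesis unfolding subdifferential_def by blast
qed

lemma min_norm_subgradient_mem:
  fixes g :: "'a::euclidean_space \<Rightarrow> real"
  assumes "convex_on UNIV g"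
  shows "min_norm_subgradient g x \<in> subdifferential g x"
proof -
  have "subdifferential g x = (\<Inter>y. {u. inner (y - x) u \<le> g y - g x})"
    unfolding subdifferential_def by (auto simp: inner_commute algebra_simps)
  then have "closed (subdifferential g x)"
    by (simp add: closed_INT closed_halfspace_le)
  then obtain u where "u \<in> subdifferential g x" "\<And>v. v \<in> subdifferential g x \<Longrightarrow> norm u \<le> norm v"
    using distance_attains_inf[of "subdifferential g x" 0] subdifferential_nonempty[OF assms]
    by auto
  then show ?thesis
    unfolding min_norm_subgradient_def by (rule_tac arg_minI[of _ u]) (auto simp: not_less)
qed

lemma continuous_on_convex_UNIV:
  fixes g :: "'a::euclidean_space \<Rightarrow> real"
  assumes "convex_on UNIV g" shows "continuous_on A g"
  using convex_on_continuous[OF open_UNIV assms] continuous_on_subset by blast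

text \<open>The affine minorant given by a subgradient makes the proximal objective coercive.\<close>

lemma prox_minimises:
  fixes g :: "'a::euclidean_space \<Rightarrow> real"
  assumes g: "convex_on UNIV g" and l: "l > 0"
  shows "l * g (prox l g x) + (1/2) * (norm (prox l g x - x))\<^sup>2 \<le> l * g z + (1/2) * (norm (z - x))\<^sup>2"
proof -
  let ?\<phi> = "\<lambda>t. l * g t + (1/2) * (norm (t - x))\<^sup>2"
  obtain u where u: "\<And>y. g y \<ge> g x + inner u (y - x)"
    using subdifferential_nonempty[OF g, of x] unfolding subdifferential_def by blast
  \<comment> \<open>Beyond this distance from \<open>x\<close> the quadratic term outweighs the slope of the minorant.\<close>
  define R where "R = 2 * l * norm u"
  have R: "R \<ge> 0" unfolding R_def using l by simp
  have far: "?\<phi> t \<ge> ?\<phi> x" if "norm (t - x) \<ge> R" for t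
  proof -
    have "l * g t \<ge> l * g x + l * inner u (t - x)"
      using mult_left_mono[OF u[of t], of l] l by (simp add: algebra_simps)
    moreover have "inner u (t - x) \<ge> - (norm u * norm (t - x))"
      using Cauchy_Schwarz_ineq2[of u "t - x"] by linarith
    then have "l * inner u (t - x) \<ge> - (l * norm u * norm (t - x))"
      using mult_left_mono[of _ _ l] l by fastforce
    moreover have "(2 * l * norm u) * norm (t - x) \<le> norm (t - x) * norm (t - x)"
      using that unfolding R_def by (intro mult_right_mono) auto
    ultimately show ?thesis by (simp add: power2_eq_square)
  qed
  have "continuous_on (cball x R) ?\<phi>"
    by (intro continuous_intros continuous_on_convex_UNIV g)
  then obtain t0 where t0: "t0 \<in> cball x R" "\<And>t. t \<in> cball x R \<Longrightarrow> ?\<phi> t0 \<le> ?\<phi> t"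
    using continuous_attains_inf[of "cball x R" ?\<phi>] R by (auto simp: mem_cball)
  have min: "?\<phi> t0 \<le> ?\<phi> t" for t
  proof (cases "t \<in> cball x R")
    case False
    then have "?\<phi> x \<le> ?\<phi> t" by (intro far) (simp add: dist_norm norm_minus_commute)
    moreover have "?\<phi> t0 \<le> ?\<phi> x" using R by (intro t0) simp
    ultimately show ?thesis by linarith
  qed (use t0 in auto)
  have "\<forall>y. \<not> ?\<phi> y < ?\<phi> (prox l g x)"
    unfolding prox_def by (rule arg_minI[of _ t0]) (use min in \<open>auto simp: not_less\<close>)
  then show ?thesis by (simp add: not_less)
qed

lemma norm_sq_affine_comb:
  fixes a b x :: "'a::real_inner"
  shows "(norm ((1 - t) *\<^sub>R a + t *\<^sub>R b - x))\<^sup>2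
    = (1 - t) * (norm (a - x))\<^sup>2 + t * (norm (b - x))\<^sup>2 - t * (1 - t) * (norm (b - a))\<^sup>2"
  by (simp add: power2_norm_eq_inner inner_diff_left inner_diff_right inner_add_left
      inner_add_right inner_commute) algebra

text \<open>
  The proximal objective is \<open>1\<close>-strongly convex, so it exceeds its minimum by at least half the
  squared distance to the minimiser: compare the minimum with the value at a point moving from
  the minimiser towards \<open>z\<close>.
\<close>

lemma prox_strong_min:
  fixes g :: "'a::euclidean_space \<Rightarrow> real" and x :: 'a
  assumes g: "convex_on UNIV g" and l: "l > 0"
  defines "y \<equiv> prox l g x"
  shows "l * g y + (1/2) * (norm (y - x))\<^sup>2 + (1/2) * (norm (z - y))\<^sup>2
    \<le> l * g z + (1/2) * (norm (z - x))\<^sup>2"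
proof -
  let ?\<phi> = "\<lambda>t. l * g t + (1/2) * (norm (t - x))\<^sup>2"
  have ineq: "?\<phi> y + (1/2) * (1 - t) * (norm (z - y))\<^sup>2 \<le> ?\<phi> z" if t: "0 < t" "t < 1" for t
  proof -
    let ?w = "(1 - t) *\<^sub>R y + t *\<^sub>R z"
    have "?\<phi> y \<le> ?\<phi> ?w" unfolding y_def by (rule prox_minimises[OF g l])
    also have "\<dots> \<le> l * ((1 - t) * g y + t * g z) + (1/2) * (norm (?w - x))\<^sup>2"
      using g t l by (intro add_right_mono mult_left_mono) (auto simp: convex_on_def)
    also have "\<dots> = (1 - t) * ?\<phi> y + t * ?\<phi> z - (1/2) * t * (1 - t) * (norm (z - y))\<^sup>2"
      unfolding norm_sq_affine_comb by (simp add: algebra_simps add_divide_distrib diff_divide_distrib)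
    finally have "t * (?\<phi> y + (1/2) * (1 - t) * (norm (z - y))\<^sup>2) \<le> t * ?\<phi> z"
      by (simp add: algebra_simps add_divide_distrib diff_divide_distrib)
    then show ?thesis using t by simp
  qed
  have "((\<lambda>t. ?\<phi> y + (1/2) * (1 - t) * (norm (z - y))\<^sup>2) \<longlongrightarrow> ?\<phi> y + (1/2) * (1 - 0) * (norm (z - y))\<^sup>2)
      (at_right (0::real))"
    by (intro tendsto_intros)
  moreover have "\<forall>\<^sub>F t in at_right (0::real). ?\<phi> y + (1/2) * (1 - t) * (norm (z - y))\<^sup>2 \<le> ?\<phi> z"
    unfolding eventually_at_right_field by (rule exI[of _ 1]) (use ineq in auto)
  ultimately have "?\<phi> y + (1/2) * (1 - 0) * (norm (z - y))\<^sup>2 \<le> ?\<phi> z"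
    by (rule tendsto_upperbound) simp
  then show ?thesis by simp
qed

text \<open>
  The Moreau envelope of \<open>g\<close> with parameter \<open>l\<close>, multiplied by \<open>l\<close>: the minimum of the proximal
  objective.
\<close>

definition scaled_envelope :: "real \<Rightarrow> ('a::real_inner \<Rightarrow> real) \<Rightarrow> 'a \<Rightarrow> real" where
  "scaled_envelope l g x = l * g (prox l g x) + (1/2) * (norm (prox l g x - x))\<^sup>2"

lemma prox_step_le:
  fixes g :: "'a::euclidean_space \<Rightarrow> real"
  assumes "convex_on UNIV g" and "l > 0"
  shows "(norm (prox l g x - z))\<^sup>2 \<le> (norm (x - z))\<^sup>2 - 2 * (scaled_envelope l g x - l * g z)"
  using prox_strong_min[OF assms, of x z] unfolding scaled_envelope_def
  by (simp add: norm_minus_commute)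

lemma scaled_envelope_le:
  fixes g :: "'a::euclidean_space \<Rightarrow> real"
  assumes "convex_on UNIV g" and "l > 0"
  shows "scaled_envelope l g x \<le> l * g x"
  using prox_minimises[OF assms, of x x] unfolding scaled_envelope_def by simp

lemma scaled_envelope_ge:
  fixes g :: "'a::euclidean_space \<Rightarrow> real"
  assumes "l > 0" and u: "u \<in> subdifferential g x"
  shows "scaled_envelope l g x \<ge> l * g x - l\<^sup>2 / 2 * (norm u)\<^sup>2"
proof -
  let ?y = "prox l g x"
  have "g ?y \<ge> g x + inner u (?y - x)" using u by (auto simp: subdifferential_def)
  then have "l * g ?y \<ge> l * g x + l * inner u (?y - x)"
    using \<open>l > 0\<close> mult_left_mono[of _ "g ?y" l] by (fastforce simp: algebra_simps)
  moreover have "0 \<le> (norm (l *\<^sub>R u + (?y - x)))\<^sup>2" by simp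
  then have "0 \<le> l\<^sup>2 * (norm u)\<^sup>2 + 2 * (l * inner u (?y - x)) + (norm (?y - x))\<^sup>2"
    unfolding power2_norm_eq_inner by (simp add: inner_add inner_commute power2_eq_square)
  ultimately show ?thesis unfolding scaled_envelope_def by simp
qed

text \<open>Partial minimisation of a jointly convex function leaves a convex function.\<close>

lemma convex_scaled_envelope:
  fixes g :: "'a::euclidean_space \<Rightarrow> real"
  assumes g: "convex_on UNIV g" and l: "l > 0"
  shows "convex_on UNIV (scaled_envelope l g)"
proof (rule convex_onI)
  fix t :: real and x x' :: 'a assume t: "0 < t" "t < 1"
  let ?y = "prox l g x" and ?y' = "prox l g x'"
  let ?z = "(1 - t) *\<^sub>R x + t *\<^sub>R x'" and ?w = "(1 - t) *\<^sub>R ?y + t *\<^sub>R ?y'"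
  have "scaled_envelope l g ?z \<le> l * g ?w + (1/2) * (norm (?w - ?z))\<^sup>2"
    unfolding scaled_envelope_def by (rule prox_minimises[OF g l])
  also have "l * g ?w \<le> l * ((1 - t) * g ?y + t * g ?y')"
    using g t l by (intro mult_left_mono) (auto simp: convex_on_def)
  also have "(norm (?w - ?z))\<^sup>2 = (norm ((1 - t) *\<^sub>R (?y - x) + t *\<^sub>R (?y' - x') - 0))\<^sup>2"
    by (simp add: algebra_simps)
  also have "\<dots> \<le> (1 - t) * (norm (?y - x))\<^sup>2 + t * (norm (?y' - x'))\<^sup>2"
    using t by (subst norm_sq_affine_comb) simp
  finally show "scaled_envelope l g ?z \<le> (1 - t) * scaled_envelope l g x + t * scaled_envelope l g x'"
    unfolding scaled_envelope_def by (simp add: algebra_simps add_divide_distrib diff_divide_distrib)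
qed simp

section \<open>Distances to convex sets\<close>

lemma closest_point_step_le:
  fixes S :: "'a::euclidean_space set"
  assumes "convex S" "closed S" "z \<in> S"
  shows "(norm (closest_point S x - z))\<^sup>2 \<le> (norm (x - z))\<^sup>2 - (infdist x S)\<^sup>2"
proof -
  let ?c = "closest_point S x"
  have "S \<noteq> {}" using assms by auto
  have "infdist x S \<le> norm (x - ?c)"
    using infdist_le[OF closest_point_in_set[OF assms(2) \<open>S \<noteq> {}\<close>]] by (simp add: dist_norm)
  then have "(infdist x S)\<^sup>2 \<le> (norm (x - ?c))\<^sup>2"
    by (intro power_mono) (auto simp: infdist_nonneg)
  moreover have "(norm (x - z))\<^sup>2 = (norm (x - ?c))\<^sup>2 + (norm (?c - z))\<^sup>2 - 2 * inner (x - ?c) (z - ?c)"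
    unfolding power2_norm_eq_inner by (simp add: inner_diff inner_commute)
  ultimately show ?thesis using closest_point_dot[OF assms, of x] by linarith
qed

lemma infdist_eq_closest_point:
  fixes S :: "'a::euclidean_space set"
  assumes "closed S" "S \<noteq> {}"
  shows "infdist x S = norm (x - closest_point S x)"
proof -
  obtain y where "y \<in> S" "infdist x S = dist x y" using infdist_attains_inf[OF assms] by blast
  with closest_point_le[OF assms(1), of y x] infdist_le[OF closest_point_in_set[OF assms], of x x]
  show ?thesis by (simp add: dist_norm)
qed

lemma convex_on_infdist:
  fixes S :: "'a::euclidean_space set"
  assumes S: "convex S" "closed S" "S \<noteq> {}"
  shows "convex_on UNIV (\<lambda>x. infdist x S)"
proof (rule convex_onI)
  fix t :: real and x x' :: 'a assume t: "0 < t" "t < 1"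
  let ?c = "closest_point S x" and ?c' = "closest_point S x'"
  have "(1 - t) *\<^sub>R ?c + t *\<^sub>R ?c' \<in> S"
    using S t closest_point_in_set[OF S(2,3)] by (intro convexD_alt) auto
  then have "infdist ((1 - t) *\<^sub>R x + t *\<^sub>R x') S
      \<le> norm ((1 - t) *\<^sub>R x + t *\<^sub>R x' - ((1 - t) *\<^sub>R ?c + t *\<^sub>R ?c'))"
    unfolding dist_norm[symmetric] by (rule infdist_le)
  also have "\<dots> = norm ((1 - t) *\<^sub>R (x - ?c) + t *\<^sub>R (x' - ?c'))"
    by (simp add: algebra_simps)
  also have "\<dots> \<le> (1 - t) * norm (x - ?c) + t * norm (x' - ?c')"
    using t by (intro norm_triangle_le) simp
  finally show "infdist ((1 - t) *\<^sub>R x + t *\<^sub>R x') S \<le> (1 - t) * infdist x S + t * infdist x' S"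
    by (simp add: infdist_eq_closest_point[OF S(2,3)])
qed simp

lemma convex_on_sum_fun:
  assumes "convex S" and "\<And>i. i \<in> I \<Longrightarrow> convex_on S (f i)"
  shows "convex_on S (\<lambda>x. \<Sum>i\<in>I. f i x)"
  using assms by (induction I rule: infinite_finite_induct) (auto simp: convex_on_const)

section \<open>Measurability of proximal steps\<close>

lemma normal_convex_integrandD:
  assumes "normal_convex_integrand \<mu> f"
  shows "(\<lambda>(s, x). f s x) \<in> borel_measurable (\<mu> \<Otimes>\<^sub>M borel)"
    and "s \<in> space \<mu> \<Longrightarrow> convex_on UNIV (f s)"
  using assms by (auto simp: normal_convex_integrand_def)

text \<open>
  The proximal point is a limit of measurable selections: among the points of a countable dense
  sequence, the first one whose proximal objective is within \<open>1 / (N + 1)\<close> of the infimum tends to the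
  minimiser as \<open>N\<close> grows, by strong convexity.
\<close>

lemma measurable_prox:
  fixes f :: "'e \<Rightarrow> 'a::euclidean_space \<Rightarrow> real"
  assumes f: "normal_convex_integrand \<mu> f" and l: "l > 0"
  shows "(\<lambda>(s, x). prox l (f s) x) \<in> borel_measurable (\<mu> \<Otimes>\<^sub>M borel)"
proof -
  note fm = normal_convex_integrandD(1)[OF f]
  obtain D :: "'a set" where D: "countable D" "\<And>X. open X \<Longrightarrow> X \<noteq> {} \<Longrightarrow> \<exists>d\<in>D. d \<in> X"
    using countable_dense_setE by blast
  have "D \<noteq> {}" using D(2)[of UNIV] by auto
  define q where "q = from_nat_into D"
  have q_dense: "\<exists>k. q k \<in> U" if U: "open U" "U \<noteq> {}" for U
    using D(2)[OF U] from_nat_into_surj[OF D(1)] unfolding q_def by metis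
  define \<phi> where "\<phi> z t = l * f (fst z) t + (1/2) * (norm (t - snd z))\<^sup>2" for z :: "'e \<times> 'a" and t
  have [measurable]: "(\<lambda>z. \<phi> z t) \<in> borel_measurable (\<mu> \<Otimes>\<^sub>M borel)" for t
  proof -
    have "(\<lambda>z. (fst z, t)) \<in> \<mu> \<Otimes>\<^sub>M (borel :: 'a measure) \<rightarrow>\<^sub>M \<mu> \<Otimes>\<^sub>M (borel :: 'a measure)" by simp
    from measurable_compose[OF this fm] show ?thesis unfolding \<phi>_def by simp
  qed
  define sel where "sel N z = q (LEAST k. \<forall>j. \<phi> z (q k) \<le> \<phi> z (q j) + 1 / real (Suc N))" for N z
  have sel_meas: "sel N \<in> borel_measurable (\<mu> \<Otimes>\<^sub>M borel)" for N
    unfolding sel_def by measurable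
  show ?thesis
  proof (rule borel_measurable_LIMSEQ_metric[OF sel_meas])
    fix z assume "z \<in> space (\<mu> \<Otimes>\<^sub>M (borel :: 'a measure))"
    then obtain s x where z: "z = (s, x)" "s \<in> space \<mu>" by (auto simp: space_pair_measure)
    define y where "y = prox l (f s) x"
    note cvx = normal_convex_integrandD(2)[OF f z(2)]
    have "continuous_on UNIV (\<phi> z)"
      unfolding \<phi>_def by (intro continuous_intros continuous_on_convex_UNIV) (simp add: z cvx)
    then have cont: "open {t. \<phi> z t < c}" for c
      using open_Collect_less[of "\<phi> z" "\<lambda>_. c"] by simp
    have ymin: "\<phi> z y + (1/2) * (norm (t - y))\<^sup>2 \<le> \<phi> z t" for t
      using prox_strong_min[OF cvx l, of x t] unfolding \<phi>_def z y_def by simp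
    have near: "(norm (sel N z - y))\<^sup>2 \<le> 2 / real (Suc N)" for N
    proof -
      let ?good = "\<lambda>k. \<forall>j. \<phi> z (q k) \<le> \<phi> z (q j) + 1 / real (Suc N)"
      have "\<exists>k. q k \<in> {t. \<phi> z t < \<phi> z y + 1 / real (Suc N)}"
        by (rule q_dense[OF cont]) (auto intro!: exI[of _ y])
      then obtain k where k: "\<phi> z (q k) < \<phi> z y + 1 / real (Suc N)" by blast
      have "?good k"
      proof
        fix j have "\<phi> z y \<le> \<phi> z (q j)" using ymin[of "q j"] zero_le_power2[of "norm (q j - y)"] by linarith
        with k show "\<phi> z (q k) \<le> \<phi> z (q j) + 1 / real (Suc N)" by linarith
      qed
      then have good: "\<phi> z (sel N z) \<le> \<phi> z (q j) + 1 / real (Suc N)" for j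
        unfolding sel_def using LeastI[of ?good k] by blast
      have "\<phi> z (sel N z) \<le> \<phi> z y + 1 / real (Suc N)"
      proof (rule ccontr)
        assume "\<not> ?thesis"
        then have "y \<in> {t. \<phi> z t < \<phi> z (sel N z) - 1 / real (Suc N)}" by simp
        then obtain j where "\<phi> z (q j) < \<phi> z (sel N z) - 1 / real (Suc N)"
          using q_dense[OF cont] by blast
        with good[of j] show False by linarith
      qed
      with ymin[of "sel N z"] show ?thesis by simp
    qed
    have bound: "(\<lambda>N. 2 * inverse (real (Suc N))) \<longlonglongrightarrow> 2 * 0"
      by (rule tendsto_mult_left[OF LIMSEQ_inverse_real_of_nat])
    have "(\<lambda>N. (norm (sel N z - y))\<^sup>2) \<longlonglongrightarrow> 0"
    proof (rule tendsto_sandwich[OF _ _ tendsto_const])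
      show "\<forall>\<^sub>F N in sequentially. (norm (sel N z - y))\<^sup>2 \<le> 2 * inverse (real (Suc N))"
        using near by (simp add: divide_inverse)
    qed (use bound in auto)
    then have "(\<lambda>N. sqrt ((norm (sel N z - y))\<^sup>2)) \<longlonglongrightarrow> sqrt 0"
      by (rule tendsto_real_sqrt)
    then have "(\<lambda>N. norm (sel N z - y)) \<longlonglongrightarrow> 0" by simp
    then have "(\<lambda>N. sel N z) \<longlonglongrightarrow> y" by (simp add: LIM_zero_iff tendsto_norm_zero_iff)
    then show "(\<lambda>N. sel N z) \<longlonglongrightarrow> (\<lambda>(s, x). prox l (f s) x) z" by (simp add: z y_def)
  qed
qed

lemma measurable_scaled_envelope:
  fixes f :: "'e \<Rightarrow> 'a::euclidean_space \<Rightarrow> real"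
  assumes f: "normal_convex_integrand \<mu> f" and l: "l > 0"
  shows "(\<lambda>(s, x). scaled_envelope l (f s) x) \<in> borel_measurable (\<mu> \<Otimes>\<^sub>M borel)"
proof -
  have p: "(\<lambda>z. prox l (f (fst z)) (snd z)) \<in> borel_measurable (\<mu> \<Otimes>\<^sub>M (borel :: 'a measure))"
    using measurable_prox[OF f l] by (simp add: case_prod_beta')
  then have "(\<lambda>z. (fst z, prox l (f (fst z)) (snd z))) \<in> \<mu> \<Otimes>\<^sub>M (borel :: 'a measure) \<rightarrow>\<^sub>M \<mu> \<Otimes>\<^sub>M (borel :: 'a measure)"
    by simp
  from measurable_compose[OF this normal_convex_integrandD(1)[OF f]] p
  show ?thesis unfolding scaled_envelope_def case_prod_beta' by simp
qed

section \<open>The mean envelope and the exact penalty\<close>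

definition mean_envelope :: "'e measure \<Rightarrow> ('e \<Rightarrow> 'a::euclidean_space \<Rightarrow> real) \<Rightarrow> real \<Rightarrow> 'a \<Rightarrow> real" where
  "mean_envelope \<mu> f l x = (\<integral>s. scaled_envelope l (f s) x \<partial>\<mu>)"

lemma convex_on_integral:
  fixes g :: "'e \<Rightarrow> 'a::real_vector \<Rightarrow> real"
  assumes int: "\<And>x. integrable M (\<lambda>s. g s x)" and cvx: "\<And>s. s \<in> space M \<Longrightarrow> convex_on UNIV (g s)"
  shows "convex_on UNIV (\<lambda>x. \<integral>s. g s x \<partial>M)"
proof (rule convex_onI)
  fix t :: real and x y :: 'a assume t: "0 < t" "t < 1"
  have "(\<integral>s. g s ((1 - t) *\<^sub>R x + t *\<^sub>R y) \<partial>M) \<le> (\<integral>s. (1 - t) * g s x + t * g s y \<partial>M)"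
    using t cvx by (intro integral_mono int Bochner_Integration.integrable_add integrable_mult_right)
      (auto simp: convex_on_def)
  also have "\<dots> = (1 - t) * (\<integral>s. g s x \<partial>M) + t * (\<integral>s. g s y \<partial>M)"
    by (simp add: int)
  finally show "(\<integral>s. g s ((1 - t) *\<^sub>R x + t *\<^sub>R y) \<partial>M) \<le> \<dots>" .
qed simp

text \<open>
  The growth condition enters the proof only here. It makes the envelope integrable and bounds the
  loss in replacing the objective by the mean envelope; since it is used at one point \<open>x\<close> at a time,
  the exceptional null set may depend on \<open>x\<close>.
\<close>

lemma mean_envelope_bounds:
  fixes f :: "'e \<Rightarrow> 'a::euclidean_space \<Rightarrow> real"
  assumes f: "normal_convex_integrand \<mu> f" and l: "l > 0"
    and f_int: "\<And>x. integrable \<mu> (\<lambda>s. f s x)"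
    and growth: "\<And>x. AE s in \<mu>. norm (min_norm_subgradient (f s) x) \<le> C s * (1 + norm x ^ p)"
    and C: "in_Lp \<mu> 2 C"
  shows integrable_scaled_envelope: "\<And>x. integrable \<mu> (\<lambda>s. scaled_envelope l (f s) x)"
    and mean_envelope_le: "\<And>x. mean_envelope \<mu> f l x \<le> l * objective \<mu> f x"
    and mean_envelope_ge: "\<And>x. mean_envelope \<mu> f l x
      \<ge> l * objective \<mu> f x - l\<^sup>2 / 2 * ((\<integral>s. (C s)\<^sup>2 \<partial>\<mu>) * (1 + norm x ^ p)\<^sup>2)"
    and convex_mean_envelope: "convex_on UNIV (mean_envelope \<mu> f l)"
proof -
  have C2: "integrable \<mu> (\<lambda>s. (C s)\<^sup>2)" using C by (simp add: in_Lp_def)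
  have upper: "scaled_envelope l (f s) x \<le> l * f s x" if "s \<in> space \<mu>" for s x
    using scaled_envelope_le[OF normal_convex_integrandD(2)[OF f that] l] .
  have lower: "AE s in \<mu>. scaled_envelope l (f s) x \<ge> l * f s x - l\<^sup>2 / 2 * ((C s)\<^sup>2 * (1 + norm x ^ p)\<^sup>2)" for x
    using growth[of x] AE_space
  proof eventually_elim
    case (elim s)
    let ?u = "min_norm_subgradient (f s) x"
    have "?u \<in> subdifferential (f s) x"
      using min_norm_subgradient_mem normal_convex_integrandD(2)[OF f elim(2)] by blast
    then have "scaled_envelope l (f s) x \<ge> l * f s x - l\<^sup>2 / 2 * (norm ?u)\<^sup>2"
      by (rule scaled_envelope_ge[OF l])
    moreover have "(norm ?u)\<^sup>2 \<le> (C s)\<^sup>2 * (1 + norm x ^ p)\<^sup>2"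
      using power_mono[OF elim(1), of 2] by (simp add: power_mult_distrib)
    then have "l\<^sup>2 / 2 * (norm ?u)\<^sup>2 \<le> l\<^sup>2 / 2 * ((C s)\<^sup>2 * (1 + norm x ^ p)\<^sup>2)"
      by (rule mult_left_mono) simp
    ultimately show ?case by linarith
  qed
  have int_lower: "integrable \<mu> (\<lambda>s. l * f s x - l\<^sup>2 / 2 * ((C s)\<^sup>2 * (1 + norm x ^ p)\<^sup>2))" for x
    using f_int C2 by (intro Bochner_Integration.integrable_diff integrable_mult_right integrable_mult_left)
  show int: "integrable \<mu> (\<lambda>s. scaled_envelope l (f s) x)" for x
  proof (rule Bochner_Integration.integrable_bound)
    show "integrable \<mu> (\<lambda>s. \<bar>l * f s x\<bar> + \<bar>l * f s x - l\<^sup>2 / 2 * ((C s)\<^sup>2 * (1 + norm x ^ p)\<^sup>2)\<bar>)"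
      using f_int by (intro Bochner_Integration.integrable_add integrable_abs int_lower integrable_mult_right)
    have "(\<lambda>s. (s, x)) \<in> \<mu> \<rightarrow>\<^sub>M \<mu> \<Otimes>\<^sub>M borel" by simp
    from measurable_compose[OF this measurable_scaled_envelope[OF f l]]
    show "(\<lambda>s. scaled_envelope l (f s) x) \<in> borel_measurable \<mu>" by simp
    show "AE s in \<mu>. norm (scaled_envelope l (f s) x)
        \<le> norm (\<bar>l * f s x\<bar> + \<bar>l * f s x - l\<^sup>2 / 2 * ((C s)\<^sup>2 * (1 + norm x ^ p)\<^sup>2)\<bar>)"
      using lower[of x] AE_space
    proof eventually_elim
      case (elim s)
      then show ?case using upper[OF elim(2), of x] unfolding real_norm_def by linarith
    qed
  qed
  show "mean_envelope \<mu> f l x \<le> l * objective \<mu> f x" for x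
  proof -
    have "mean_envelope \<mu> f l x \<le> (\<integral>s. l * f s x \<partial>\<mu>)"
      unfolding mean_envelope_def by (intro integral_mono int integrable_mult_right f_int upper)
    then show ?thesis by (simp add: objective_def)
  qed
  show "mean_envelope \<mu> f l x
      \<ge> l * objective \<mu> f x - l\<^sup>2 / 2 * ((\<integral>s. (C s)\<^sup>2 \<partial>\<mu>) * (1 + norm x ^ p)\<^sup>2)" for x
  proof -
    have "(\<integral>s. l * f s x - l\<^sup>2 / 2 * ((C s)\<^sup>2 * (1 + norm x ^ p)\<^sup>2) \<partial>\<mu>) \<le> mean_envelope \<mu> f l x"
      unfolding mean_envelope_def by (intro integral_mono_AE int int_lower lower)
    moreover have "(\<integral>s. l * f s x - l\<^sup>2 / 2 * ((C s)\<^sup>2 * (1 + norm x ^ p)\<^sup>2) \<partial>\<mu>)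
        = (\<integral>s. l * f s x \<partial>\<mu>) - (\<integral>s. l\<^sup>2 / 2 * ((C s)\<^sup>2 * (1 + norm x ^ p)\<^sup>2) \<partial>\<mu>)"
      using f_int C2 by (intro Bochner_Integration.integral_diff integrable_mult_right integrable_mult_left)
    ultimately show ?thesis by (simp add: objective_def)
  qed
  show "convex_on UNIV (mean_envelope \<mu> f l)"
    unfolding mean_envelope_def
    by (intro convex_on_integral int convex_scaled_envelope l normal_convex_integrandD(2)[OF f])
qed

text \<open>
  Outside the unit ball around \<open>z\<close>, a convex function lies above the line through its values at \<open>z\<close>
  and at the point where the ray from \<open>z\<close> crosses the unit sphere.
\<close>

lemma convex_lower_growth:
  fixes H :: "'a::real_normed_vector \<Rightarrow> real"
  assumes H: "convex_on UNIV H" and z: "H z \<le> 0" and c: "c \<ge> 0"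
    and near: "\<And>x. norm (x - z) \<le> 1 \<Longrightarrow> H x \<ge> - c"
  shows "H x \<ge> - c * (1 + norm (x - z))"
proof (cases "norm (x - z) \<le> 1")
  case True
  have "c * 1 \<le> c * (1 + norm (x - z))" using c by (intro mult_left_mono) auto
  with near[OF True] show ?thesis by simp
next
  case False
  define r where "r = norm (x - z)"
  define t where "t = 1 / r"
  have r: "r > 1" using False by (simp add: r_def)
  then have t: "0 < t" "t < 1" "t * r = 1" by (auto simp: t_def)
  let ?w = "(1 - t) *\<^sub>R z + t *\<^sub>R x"
  have "?w - z = t *\<^sub>R (x - z)" by (simp add: algebra_simps)
  then have "norm (?w - z) = 1" using t by (simp add: r_def)
  then have "- c \<le> H ?w" by (intro near) simp
  also have "\<dots> \<le> (1 - t) * H z + t * H x" using H t by (auto simp: convex_on_def)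
  also have "\<dots> \<le> t * H x" using t z by (simp add: mult_le_0_iff)
  finally have "r * (- c) \<le> r * (t * H x)" using r by (intro mult_left_mono) auto
  also have "r * (t * H x) = (t * r) * H x" by (simp only: ac_simps)
  finally have "- (c * r) \<le> H x" using t(3) by (simp add: mult.commute)
  then show ?thesis using c by (simp add: r_def algebra_simps)
qed

text \<open>
  For \<open>x\<close> and \<open>y\<close> in the unit ball, extend the segment from \<open>x\<close> to \<open>y\<close> by one unit beyond \<open>y\<close>, which
  stays in the ball of radius \<open>2\<close>, where \<open>F\<close> is bounded.
\<close>

lemma convex_locally_Lipschitz:
  fixes F :: "'a::euclidean_space \<Rightarrow> real"
  assumes F: "convex_on UNIV F"
  obtains L where "L \<ge> 0"
    and "\<And>x y. norm (x - z) \<le> 1 \<Longrightarrow> norm (y - z) \<le> 1 \<Longrightarrow> F y - F x \<le> L * norm (y - x)"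
proof -
  have "compact (F ` cball z 2)"
    by (intro compact_continuous_image continuous_on_convex_UNIV F compact_cball)
  then obtain B where "\<forall>v\<in>F ` cball z 2. norm v \<le> B"
    using compact_imp_bounded bounded_iff by blast
  then have B: "\<bar>F w\<bar> \<le> B" if "norm (w - z) \<le> 2" for w
    using that by (simp add: dist_norm norm_minus_commute)
  have "B \<ge> 0" using B[of z] by simp
  moreover have "F y - F x \<le> 2 * B * norm (y - x)" if xy: "norm (x - z) \<le> 1" "norm (y - z) \<le> 1" for x y
  proof (cases "y = x")
    case False
    define r where "r = norm (y - x)"
    have r: "r > 0" using False by (simp add: r_def)
    \<comment> \<open>The point \<open>y\<close> divides the segment from \<open>x\<close> to \<open>w\<close> in the ratio \<open>r : 1\<close>.\<close>
    define t where "t = r / (1 + r)"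
    have t: "0 < t" "t < 1" "t \<le> r" using r by (auto simp: t_def field_simps)
    define w where "w = y + (1 / r) *\<^sub>R (y - x)"
    have "t / r = 1 / (1 + r)" using r by (simp add: t_def)
    then have "t + t / r = (r + 1) / (1 + r)" unfolding t_def by (simp add: add_divide_distrib)
    also have "\<dots> = 1" using r by (simp add: add.commute)
    finally have "t + t / r = 1" .
    then have "t *\<^sub>R (y - x) + (t / r) *\<^sub>R (y - x) = y - x"
      by (metis scaleR_left.add scaleR_one)
    then have comb: "(1 - t) *\<^sub>R x + t *\<^sub>R w = y"
      by (simp add: w_def algebra_simps)
    have "norm (w - z) \<le> norm (y - z) + norm ((1 / r) *\<^sub>R (y - x))"
      using norm_triangle_ineq[of "y - z" "(1 / r) *\<^sub>R (y - x)"] by (simp add: w_def algebra_simps)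
    also have "norm ((1 / r) *\<^sub>R (y - x)) = 1" using r by (simp add: r_def)
    finally have w: "norm (w - z) \<le> 2" using xy by simp
    have "F y \<le> (1 - t) * F x + t * F w" 
      unfolding comb[symmetric] using convex_onD[OF F, of t x w] t by simp
    then have "F y - F x \<le> t * (F w - F x)" by (simp add: algebra_simps)
    also have "\<dots> \<le> t * (2 * B)" using B[OF w] B[of x] xy t by (intro mult_left_mono) auto
    also have "\<dots> \<le> r * (2 * B)" using t \<open>B \<ge> 0\<close> by (intro mult_right_mono) auto
    finally show ?thesis by (simp add: r_def mult.commute)
  qed simp
  ultimately show ?thesis using that[of "2 * B"] by simp
qed

text \<open>
  Near \<open>z\<close> the penalty dominates the possible decrease of \<open>F\<close> off the feasible set, by the Lipschitz
  bound and linear regularity. Convexity extends the inequality to the whole space, although the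
  regularity constant may degenerate far away.
\<close>

lemma exact_penalty:
  fixes F :: "'a::euclidean_space \<Rightarrow> real"
  assumes F: "convex_on UNIV F" and m: "m \<ge> 1"
    and X: "\<And>i. i \<in> {1..m} \<Longrightarrow> X i \<noteq> {} \<and> closed (X i) \<and> convex (X i)"
    and regular: "boundedly_linearly_regular m X"
    and z: "z \<in> (\<Inter>i\<in>{1..m}. X i)" and min: "\<And>y. y \<in> (\<Inter>i\<in>{1..m}. X i) \<Longrightarrow> F z \<le> F y"
  obtains K where "K \<ge> 0" and "\<And>x. F x + K * (\<Sum>i=1..m. infdist x (X i)) \<ge> F z"
proof -
  let ?S = "\<Inter>i\<in>{1..m}. X i" and ?D = "\<lambda>x. \<Sum>i=1..m. infdist x (X i)"
  obtain L where L: "L \<ge> 0" "\<And>x y. norm (x - z) \<le> 1 \<Longrightarrow> norm (y - z) \<le> 1 \<Longrightarrow> F y - F x \<le> L * norm (y - x)"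
    using convex_locally_Lipschitz[OF F] by metis
  have "norm z + 1 > 0" using norm_ge_zero[of z] by linarith
  then obtain \<kappa> where \<kappa>: "\<kappa> > 0" "\<And>x. norm x \<le> norm z + 1 \<Longrightarrow> \<kappa> * infdist x ?S \<le> (MAX i\<in>{1..m}. infdist x (X i))"
    using regular unfolding boundedly_linearly_regular_def by metis
  define K where "K = L / \<kappa>"
  have K: "K \<ge> 0" using L \<kappa> by (simp add: K_def)
  have S: "convex ?S" "closed ?S" using X by (auto intro!: convex_INT closed_INT)
  let ?H = "\<lambda>x. F x + K * ?D x + (- F z)"
  have "convex_on UNIV ?H"
    using K X by (intro convex_on_add F convex_on_cmul convex_on_sum_fun convex_on_infdist iffD2[OF convex_on_const]) auto
  moreover have "?D z = 0" using z by simp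
  then have "?H z \<le> 0" by simp
  moreover have "?H x \<ge> - 0" if x: "norm (x - z) \<le> 1" for x
  proof -
    let ?p = "closest_point ?S x"
    have p: "?p \<in> ?S" using closest_point_in_set[OF S(2)] z by blast
    have "(norm (?p - z))\<^sup>2 \<le> (norm (x - z))\<^sup>2"
      using closest_point_step_le[OF S z, of x] by (smt (verit) zero_le_power2)
    then have "norm (?p - z) \<le> 1" using x by (meson norm_ge_zero order_trans power2_le_imp_le)
    then have "F ?p - F x \<le> L * norm (?p - x)" using L x by blast
    also have "norm (?p - x) = infdist x ?S"
      using infdist_eq_closest_point[OF S(2)] z by (metis empty_iff norm_minus_commute)
    finally have 1: "F z \<le> F x + L * infdist x ?S" using min[OF p] by linarith
    have "norm x \<le> norm z + 1" using x norm_triangle_sub[of x z] by linarith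
    then have "\<kappa> * infdist x ?S \<le> (MAX i\<in>{1..m}. infdist x (X i))" by (rule \<kappa>)
    also have "\<dots> \<le> ?D x"
      using m by (subst Max_le_iff) (auto intro!: member_le_sum simp: infdist_nonneg)
    finally have "K * (\<kappa> * infdist x ?S) \<le> K * ?D x" using K by (rule mult_left_mono)
    then have "L * infdist x ?S \<le> K * ?D x" using \<kappa> by (simp add: K_def)
    with 1 show ?thesis by simp
  qed
  ultimately have "?H x \<ge> - 0 * (1 + norm (x - z))" for x
    by (rule convex_lower_growth[OF _ _ order_refl])
  then show ?thesis using that[OF K] by simp
qed

text \<open>
  The mean envelope inherits the penalised lower bound up to second order in the step. The bound on
  the loss grows with \<open>norm x ^ p\<close>, but it is only needed near \<open>z\<close>: convexity makes the error grow
  linearly, which squared distances can absorb.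
\<close>

lemma mean_envelope_penalty:
  fixes f :: "'e \<Rightarrow> 'a::euclidean_space \<Rightarrow> real"
  assumes f: "normal_convex_integrand \<mu> f" and f_int: "\<And>x. integrable \<mu> (\<lambda>s. f s x)"
    and growth: "\<And>x. AE s in \<mu>. norm (min_norm_subgradient (f s) x) \<le> C s * (1 + norm x ^ p)"
    and C: "in_Lp \<mu> 2 C"
    and X: "\<And>i. i \<in> {1..m} \<Longrightarrow> X i \<noteq> {} \<and> closed (X i) \<and> convex (X i)"
    and z: "z \<in> (\<Inter>i\<in>{1..m}. X i)" and K: "K \<ge> 0"
    and penalty: "\<And>x. objective \<mu> f x + K * (\<Sum>i=1..m. infdist x (X i)) \<ge> objective \<mu> f z"
  obtains c where "c \<ge> 0" and "\<And>l x. l > 0 \<Longrightarrow>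
    mean_envelope \<mu> f l x - l * objective \<mu> f z + l * K * (\<Sum>i=1..m. infdist x (X i))
      \<ge> - c * l\<^sup>2 * (1 + norm (x - z))"
proof -
  let ?D = "\<lambda>x. \<Sum>i=1..m. infdist x (X i)"
  define I where "I = (\<integral>s. (C s)\<^sup>2 \<partial>\<mu>)"
  have I: "I \<ge> 0" unfolding I_def by (rule integral_nonneg_AE) simp
  define c where "c = 1 / 2 * (I * (1 + (norm z + 1) ^ p)\<^sup>2)"
  have c: "c \<ge> 0" using I by (simp add: c_def)
  have "mean_envelope \<mu> f l x - l * objective \<mu> f z + l * K * ?D x \<ge> - c * l\<^sup>2 * (1 + norm (x - z))"
    if l: "l > 0" for l x
  proof -
    note env = mean_envelope_le[OF f l f_int growth C] mean_envelope_ge[OF f l f_int growth C]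
      convex_mean_envelope[OF f l f_int growth C]
    let ?H = "\<lambda>x. mean_envelope \<mu> f l x + (- (l * objective \<mu> f z)) + l * K * ?D x"
    have "convex_on UNIV ?H"
      using K X l by (intro convex_on_add env(3) convex_on_cmul convex_on_sum_fun convex_on_infdist iffD2[OF convex_on_const]) auto
    moreover have "?D z = 0" using z by simp
    then have "?H z \<le> 0" using env(1)[of z] by simp
    moreover have "c * l\<^sup>2 \<ge> 0" using c by simp
    moreover have "?H x \<ge> - (c * l\<^sup>2)" if x: "norm (x - z) \<le> 1" for x
    proof -
      have "norm x \<le> norm z + 1" using x norm_triangle_sub[of x z] by linarith
      then have "(1 + norm x ^ p)\<^sup>2 \<le> (1 + (norm z + 1) ^ p)\<^sup>2"
        by (intro power_mono add_left_mono) auto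
      then have "l\<^sup>2 / 2 * (I * (1 + norm x ^ p)\<^sup>2) \<le> l\<^sup>2 / 2 * (I * (1 + (norm z + 1) ^ p)\<^sup>2)"
        using I by (intro mult_left_mono) auto
      also have "\<dots> = c * l\<^sup>2" by (simp add: c_def)
      finally have "mean_envelope \<mu> f l x \<ge> l * objective \<mu> f x - c * l\<^sup>2"
        using env(2)[of x] unfolding I_def by linarith
      moreover have "l * objective \<mu> f z \<le> l * (objective \<mu> f x + K * ?D x)"
        using penalty[of x] l by (intro mult_left_mono) auto
      ultimately show ?thesis by (simp add: algebra_simps)
    qed
    ultimately have "?H x \<ge> - (c * l\<^sup>2) * (1 + norm (x - z))"
      by (rule convex_lower_growth)
    then show ?thesis by simp
  qed
  with c show ?thesis by (rule that)
qed

section \<open>Almost supermartingales\<close>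

text \<open>
  Upcrossings of \<open>[a, b]\<close> are counted with the strategy of Doob: buy below \<open>a\<close>, hold until the value
  exceeds \<open>b\<close>. The predicate \<open>holding\<close> tells whether one unit is held from time \<open>n\<close> to time \<open>n + 1\<close>,
  and \<open>gain\<close> is the accumulated profit.
\<close>

primrec holding :: "real \<Rightarrow> real \<Rightarrow> (nat \<Rightarrow> real) \<Rightarrow> nat \<Rightarrow> bool" where
  "holding a b y 0 \<longleftrightarrow> y 0 < a"
| "holding a b y (Suc n) \<longleftrightarrow> (if holding a b y n then y (Suc n) \<le> b else y (Suc n) < a)"

primrec gain :: "real \<Rightarrow> real \<Rightarrow> (nat \<Rightarrow> real) \<Rightarrow> nat \<Rightarrow> real" where
  "gain a b y 0 = 0"
| "gain a b y (Suc n) = gain a b y n + (if holding a b y n then y (Suc n) - y n else 0)"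

primrec upcrossings :: "real \<Rightarrow> real \<Rightarrow> (nat \<Rightarrow> real) \<Rightarrow> nat \<Rightarrow> nat" where
  "upcrossings a b y 0 = 0"
| "upcrossings a b y (Suc n) =
     upcrossings a b y n + (if holding a b y n \<and> y (Suc n) > b then 1 else 0)"

text \<open>
  Each completed upcrossing earns at least \<open>b - a\<close>; the last, open position may show a loss, which is
  at most \<open>a\<close> for a nonnegative sequence.
\<close>

lemma upcrossings_le_gain:
  assumes "a < b" and "a \<ge> 0" and "y n \<ge> 0"
  shows "(b - a) * real (upcrossings a b y n) \<le> gain a b y n + a"
proof -
  have "(b - a) * real (upcrossings a b y n) + (if holding a b y n then y n - a else 0) \<le> gain a b y n"
    using \<open>a < b\<close> by (induction n) (auto simp: algebra_simps)
  then show ?thesis using assms by (auto split: if_splits)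
qed

lemma upcrossings_mono: "m \<le> n \<Longrightarrow> upcrossings a b y m \<le> upcrossings a b y n"
  by (rule lift_Suc_mono_le[of "upcrossings a b y"]) auto

lemma upcrossings_unbounded:
  assumes low: "\<exists>\<^sub>F n in sequentially. y n < a" and high: "\<exists>\<^sub>F n in sequentially. y n > b"
  shows "\<exists>n. upcrossings a b y n \<ge> k"
proof (induction k)
  case (Suc k)
  then obtain n where n: "upcrossings a b y n \<ge> k" by blast
  have "\<exists>m\<ge>n. holding a b y m"
  proof (rule ccontr)
    assume never: "\<not> ?thesis"
    obtain m where m: "m > n" "y m < a"
      using low by (meson frequently_sequentially less_le_trans lessI)
    then obtain i where "m = Suc i" "i \<ge> n" by (cases m) auto
    moreover from this never have "\<not> holding a b y i" "\<not> holding a b y (Suc i)"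
      by (auto simp del: holding.simps)
    ultimately show False using m by simp
  qed
  then obtain m where m: "m \<ge> n" "holding a b y m" by blast
  have "\<exists>i\<ge>m. holding a b y i \<and> y (Suc i) > b"
  proof (rule ccontr)
    assume never: "\<not> ?thesis"
    have "holding a b y i" if "i \<ge> m" for i
      using that by (induction rule: dec_induct) (use m never in \<open>auto simp: not_less\<close>)
    then have "y i \<le> b" if "i \<ge> Suc m" for i
      using that never by (cases i) (auto simp: not_less)
    then show False using high by (meson frequently_sequentially leD)
  qed
  then obtain i where i: "i \<ge> m" "holding a b y i" "y (Suc i) > b" by blast
  have "upcrossings a b y (Suc i) \<ge> Suc k"
    using i n m(1) upcrossings_mono[of n i a b y] by simp
  then show ?case by blast
qed simp

lemma convergent_if_finite_upcrossings:
  fixes y :: "nat \<Rightarrow> real"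
  assumes nonneg: "\<And>n. y n \<ge> 0"
    and fin: "\<And>a b :: rat. 0 \<le> a \<Longrightarrow> a < b \<Longrightarrow> \<exists>k. \<forall>n. upcrossings (of_rat a) (of_rat b) y n \<le> k"
    and bdd: "\<exists>c. \<exists>\<^sub>F n in sequentially. y n \<le> c"
  shows "convergent y"
proof -
  let ?z = "\<lambda>n. ereal (y n)"
  have "limsup ?z \<le> liminf ?z"
  proof (rule ccontr)
    assume "\<not> ?thesis"
    then have "liminf ?z < limsup ?z" by simp
    then obtain a where a: "liminf ?z < ereal (of_rat a)" "ereal (of_rat a) < limsup ?z"
      using ereal_dense3 by blast
    then obtain b where b: "ereal (of_rat a) < ereal (of_rat b)" "ereal (of_rat b) < limsup ?z"
      using ereal_dense3 by blast
    have "0 \<le> liminf ?z" by (rule Liminf_bounded) (simp add: nonneg)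
    with a have "ereal 0 < ereal (of_rat a)" by (metis le_less_trans zero_ereal_def)
    then have "0 \<le> a" "a < b" using b by (auto simp: of_rat_less)
    then obtain k where k: "\<And>n. upcrossings (of_rat a) (of_rat b) y n \<le> k" using fin by blast
    have "\<exists>\<^sub>F n in sequentially. y n < of_rat a"
    proof (rule ccontr)
      assume "\<not> ?thesis"
      then have "\<forall>\<^sub>F n in sequentially. ereal (of_rat a) \<le> ?z n"
        by (simp add: not_frequently not_less)
      from Liminf_bounded[OF this] a(1) show False by simp
    qed
    moreover have "\<exists>\<^sub>F n in sequentially. y n > of_rat b"
    proof (rule ccontr)
      assume "\<not> ?thesis"
      then have "\<forall>\<^sub>F n in sequentially. ?z n \<le> ereal (of_rat b)"
        by (simp add: not_frequently not_less)
      from Limsup_bounded[OF this] b(2) show False by simp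
    qed
    ultimately obtain n where "upcrossings (of_rat a) (of_rat b) y n \<ge> Suc k"
      using upcrossings_unbounded by blast
    with k[of n] show False by simp
  qed
  then have eq: "liminf ?z = limsup ?z" by (intro antisym Liminf_le_Limsup) auto
  then have lim: "?z \<longlonglongrightarrow> limsup ?z" by (intro Liminf_eq_Limsup) auto
  obtain c where c: "\<exists>\<^sub>F n in sequentially. y n \<le> c" using bdd by blast
  have "liminf ?z \<le> ereal c"
  proof (rule ccontr)
    assume "\<not> ?thesis"
    then have "\<forall>\<^sub>F n in sequentially. ereal c < ?z n" by (auto dest: less_LiminfD simp: not_le)
    with c show False by (auto simp: frequently_def not_le elim: eventually_mono)
  qed
  moreover have "0 \<le> limsup ?z" by (rule Limsup_bounded[THEN order_trans[rotated]] le_Limsup | simp add: nonneg)+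
  ultimately obtain r where "limsup ?z = ereal r" using eq by (cases "limsup ?z") auto
  with lim have "y \<longlonglongrightarrow> r" by simp
  then show ?thesis by (auto simp: convergent_def)
qed

text \<open>
  Whether one unit is held at time \<open>n\<close> is an event of the past, so the mean gain of the strategy above
  is at most the sum of the errors \<open>e n\<close>. Hence the mean number of upcrossings is bounded, almost every path
  crosses each rational interval finitely often, and Fatou's lemma excludes an infinite limit.
\<close>

theorem (in prob_space) almost_supermartingale_convergent:
  fixes Y :: "nat \<Rightarrow> 'a \<Rightarrow> real" and F :: "nat \<Rightarrow> 'a measure"
  assumes space_F: "\<And>n. space (F n) = space M"
    and sets_F: "\<And>n. sets (F n) \<subseteq> sets M" and mono_F: "\<And>n. sets (F n) \<subseteq> sets (F (Suc n))"
    and adapted: "\<And>n. Y n \<in> borel_measurable (F n)"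
    and int: "\<And>n. integrable M (Y n)" and nonneg: "\<And>n \<omega>. Y n \<omega> \<ge> 0"
    and e: "\<And>n. e n \<ge> 0" "summable e"
    and drift: "\<And>n A. A \<in> sets (F n) \<Longrightarrow>
      (\<integral>\<omega>. indicator A \<omega> * Y (Suc n) \<omega> \<partial>M) \<le> (\<integral>\<omega>. indicator A \<omega> * Y n \<omega> \<partial>M) + e n"
  shows "AE \<omega> in M. convergent (\<lambda>n. Y n \<omega>)"
proof -
  have e_sum: "(\<Sum>k<n. e k) \<le> suminf e" for n by (rule sum_le_suminf) (use e in auto)
  define A where "A a b n = {\<omega> \<in> space M. holding a b (\<lambda>k. Y k \<omega>) n}" for a b n
  have below: "{\<omega> \<in> space M. Y n \<omega> < c} \<in> sets (F n)" for n c
    using adapted[of n] borel_measurable_iff_less space_F by metis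
  have upto: "{\<omega> \<in> space M. Y n \<omega> \<le> c} \<in> sets (F n)" for n c
    using adapted[of n] borel_measurable_iff_le space_F by metis
  have A_sets: "A a b n \<in> sets (F n)" for a b n
  proof (induction n)
    case 0 show ?case using below by (simp add: A_def)
  next
    case (Suc n)
    then have "A a b n \<in> sets (F (Suc n))" using mono_F by blast
    moreover have "A a b (Suc n) = (A a b n \<inter> {\<omega> \<in> space M. Y (Suc n) \<omega> \<le> b})
        \<union> ({\<omega> \<in> space M. Y (Suc n) \<omega> < a} - A a b n)"
      by (auto simp: A_def)
    ultimately show ?case using below upto by simp
  qed
  have Aint: "integrable M (\<lambda>\<omega>. indicator (A a b n) \<omega> * Y m \<omega>)" for a b n m
    using integrable_real_mult_indicator[OF subsetD[OF sets_F A_sets] int] by (simp add: mult.commute)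
  have gain_Suc: "gain a b (\<lambda>k. Y k \<omega>) (Suc n) = gain a b (\<lambda>k. Y k \<omega>) n
      + (indicator (A a b n) \<omega> * Y (Suc n) \<omega> - indicator (A a b n) \<omega> * Y n \<omega>)"
    if "\<omega> \<in> space M" for a b n \<omega>
    using that by (simp add: A_def indicator_def)
  have gain_int: "integrable M (\<lambda>\<omega>. gain a b (\<lambda>k. Y k \<omega>) n)" for a b n
  proof (induction n)
    case (Suc n)
    then show ?case
      by (subst Bochner_Integration.integrable_cong[OF refl gain_Suc])
        (intro Bochner_Integration.integrable_add Bochner_Integration.integrable_diff Aint | simp)+
  qed simp
  have gain_le: "(\<integral>\<omega>. gain a b (\<lambda>k. Y k \<omega>) n \<partial>M) \<le> (\<Sum>k<n. e k)" for a b n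
  proof (induction n)
    case (Suc n)
    have "(\<integral>\<omega>. gain a b (\<lambda>k. Y k \<omega>) (Suc n) \<partial>M)
        = (\<integral>\<omega>. gain a b (\<lambda>k. Y k \<omega>) n \<partial>M)
          + ((\<integral>\<omega>. indicator (A a b n) \<omega> * Y (Suc n) \<omega> \<partial>M) - (\<integral>\<omega>. indicator (A a b n) \<omega> * Y n \<omega> \<partial>M))"
      by (subst Bochner_Integration.integral_cong[OF refl gain_Suc])
        (simp_all add: gain_int Aint)
    with Suc drift[OF A_sets, of a b n] show ?case by simp
  qed simp
  have ups_meas: "(\<lambda>\<omega>. real (upcrossings a b (\<lambda>k. Y k \<omega>) n)) \<in> borel_measurable M" for a b n
  proof (induction n)
    case (Suc n)
    have [measurable]: "A a b n \<in> sets M" "Y (Suc n) \<in> borel_measurable M"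
      using A_sets sets_F int by blast+
    have eq: "real (upcrossings a b (\<lambda>k. Y k \<omega>) (Suc n)) = real (upcrossings a b (\<lambda>k. Y k \<omega>) n)
        + indicator (A a b n \<inter> {\<omega> \<in> space M. Y (Suc n) \<omega> > b}) \<omega>" if "\<omega> \<in> space M" for \<omega>
      using that by (simp add: A_def indicator_def)
    show ?case by (subst measurable_cong[OF eq]) (use Suc in \<open>auto simp del: upcrossings.simps\<close>)
  qed simp
  have ups_fin: "AE \<omega> in M. \<exists>k. \<forall>n. upcrossings a b (\<lambda>k. Y k \<omega>) n \<le> k" if ab: "0 \<le> a" "a < b" for a b
  proof -
    let ?u = "\<lambda>n \<omega>. ennreal (real (upcrossings a b (\<lambda>k. Y k \<omega>) n))"
    have "(\<integral>\<^sup>+\<omega>. ?u n \<omega> \<partial>M) \<le> ennreal ((suminf e + a) / (b - a))" for n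
    proof -
      have "(\<integral>\<^sup>+\<omega>. ?u n \<omega> \<partial>M) \<le> (\<integral>\<^sup>+\<omega>. ennreal ((gain a b (\<lambda>k. Y k \<omega>) n + a) / (b - a)) \<partial>M)"
        using upcrossings_le_gain[OF ab(2,1) nonneg] ab
        by (intro nn_integral_mono ennreal_leI) (simp add: field_simps)
      also have "\<dots> = ennreal (\<integral>\<omega>. (gain a b (\<lambda>k. Y k \<omega>) n + a) / (b - a) \<partial>M)"
      proof (rule nn_integral_eq_integral)
        have "0 \<le> gain a b (\<lambda>k. Y k \<omega>) n + a" for \<omega>
          by (rule order_trans[OF _ upcrossings_le_gain[OF ab(2,1) nonneg]]) (use ab in simp)
        then show "AE \<omega> in M. 0 \<le> (gain a b (\<lambda>k. Y k \<omega>) n + a) / (b - a)" using ab by simp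
      qed (simp add: gain_int)
      also have "\<dots> \<le> ennreal ((suminf e + a) / (b - a))"
        using gain_le[of a b n] e_sum[of n] ab
        by (intro ennreal_leI) (simp add: gain_int prob_space divide_right_mono)
      finally show ?thesis .
    qed
    then have "(SUP n. \<integral>\<^sup>+\<omega>. ?u n \<omega> \<partial>M) \<le> ennreal ((suminf e + a) / (b - a))" by (rule SUP_least)
    moreover have "(SUP n. \<integral>\<^sup>+\<omega>. ?u n \<omega> \<partial>M) = (\<integral>\<^sup>+\<omega>. (SUP n. ?u n \<omega>) \<partial>M)"
      using ups_meas by (intro nn_integral_monotone_convergence_SUP[symmetric])
        (auto simp: incseq_def le_fun_def upcrossings_mono)
    ultimately have "(\<integral>\<^sup>+\<omega>. (SUP n. ?u n \<omega>) \<partial>M) \<noteq> \<infinity>" by (auto simp: top_unique)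
    then have "AE \<omega> in M. (SUP n. ?u n \<omega>) \<noteq> \<infinity>"
      using ups_meas by (intro nn_integral_noteq_infinite) auto
    then show ?thesis
    proof eventually_elim
      case (elim \<omega>)
      then obtain r where r: "r \<ge> 0" "(SUP n. ?u n \<omega>) = ennreal r" by (cases "SUP n. ?u n \<omega>") auto
      have "upcrossings a b (\<lambda>k. Y k \<omega>) n \<le> nat \<lceil>r\<rceil>" for n
      proof -
        have "?u n \<omega> \<le> ennreal r" unfolding r(2)[symmetric] by (rule SUP_upper) simp
        then have "real (upcrossings a b (\<lambda>k. Y k \<omega>) n) \<le> r" using r(1) by simp
        then show ?thesis by linarith
      qed
      then show ?case by blast
    qed
  qed
  have "AE \<omega> in M. \<forall>a b :: rat. 0 \<le> a \<longrightarrow> a < b \<longrightarrow>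
      (\<exists>k. \<forall>n. upcrossings (of_rat a) (of_rat b) (\<lambda>k. Y k \<omega>) n \<le> k)"
    unfolding AE_all_countable by (intro allI AE_impI ups_fin) (simp_all add: of_rat_less)
  moreover have "AE \<omega> in M. \<exists>c. \<exists>\<^sub>F n in sequentially. Y n \<omega> \<le> c"
  proof -
    have mean: "(\<integral>\<omega>. Y n \<omega> \<partial>M) \<le> (\<integral>\<omega>. Y 0 \<omega> \<partial>M) + (\<Sum>k<n. e k)" for n
    proof (induction n)
      case (Suc n)
      have "(\<integral>\<omega>. indicator (space M) \<omega> * Y m \<omega> \<partial>M) = (\<integral>\<omega>. Y m \<omega> \<partial>M)" for m
        by (rule Bochner_Integration.integral_cong) auto
      then show ?case using drift[of "space M" n] sets.top[of "F n"] Suc by (simp add: space_F)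
    qed simp
    have [measurable]: "Y n \<in> borel_measurable M" for n using int by blast
    have "(\<integral>\<^sup>+\<omega>. liminf (\<lambda>n. ennreal (Y n \<omega>)) \<partial>M) \<le> liminf (\<lambda>n. \<integral>\<^sup>+\<omega>. ennreal (Y n \<omega>) \<partial>M)"
      by (rule nn_integral_liminf) simp
    also have "\<dots> \<le> limsup (\<lambda>n. \<integral>\<^sup>+\<omega>. ennreal (Y n \<omega>) \<partial>M)"
      by (rule Liminf_le_Limsup) simp
    also have "\<dots> \<le> ennreal ((\<integral>\<omega>. Y 0 \<omega> \<partial>M) + suminf e)"
    proof (intro Limsup_bounded always_eventually allI)
      fix n
      show "(\<integral>\<^sup>+\<omega>. ennreal (Y n \<omega>) \<partial>M) \<le> ennreal ((\<integral>\<omega>. Y 0 \<omega> \<partial>M) + suminf e)"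
        using mean[of n] e_sum[of n] by (subst nn_integral_eq_integral[OF int]) (auto simp: nonneg intro!: ennreal_leI)
    qed
    finally have "(\<integral>\<^sup>+\<omega>. liminf (\<lambda>n. ennreal (Y n \<omega>)) \<partial>M) \<noteq> \<infinity>" by (auto simp: top_unique)
    then have "AE \<omega> in M. liminf (\<lambda>n. ennreal (Y n \<omega>)) \<noteq> \<infinity>"
      by (intro nn_integral_noteq_infinite) auto
    then show ?thesis
    proof eventually_elim
      case (elim \<omega>)
      then obtain r where r: "r \<ge> 0" "liminf (\<lambda>n. ennreal (Y n \<omega>)) = ennreal r"
        by (cases "liminf (\<lambda>n. ennreal (Y n \<omega>))") auto
      have "\<exists>\<^sub>F n in sequentially. Y n \<omega> \<le> r + 1"
      proof (rule ccontr)
        assume "\<not> ?thesis"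
        then have "\<forall>\<^sub>F n in sequentially. ennreal (r + 1) \<le> ennreal (Y n \<omega>)"
          unfolding not_frequently by eventually_elim (auto intro: ennreal_leI)
        from Liminf_bounded[OF this] r show False by (simp add: nonneg)
      qed
      then show ?case by blast
    qed
  qed
  ultimately show ?thesis
    by eventually_elim (rule convergent_if_finite_upcrossings; simp add: nonneg)
qed

text \<open>
  The Robbins--Siegmund theorem with deterministic coefficients. The recursion for the means keeps them
  bounded, so the relative error \<open>a n * V n\<close> has summable mean.
\<close>

theorem (in prob_space) Robbins_Siegmund:
  fixes V W :: "nat \<Rightarrow> 'a \<Rightarrow> real" and F :: "nat \<Rightarrow> 'a measure"
  assumes space_F: "\<And>n. space (F n) = space M"
    and sets_F: "\<And>n. sets (F n) \<subseteq> sets M" and mono_F: "\<And>n. sets (F n) \<subseteq> sets (F (Suc n))"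
    and V_adapted: "\<And>n. V n \<in> borel_measurable (F n)" and W_meas: "\<And>n. W n \<in> borel_measurable M"
    and V0: "integrable M (V 0)"
    and V_nonneg: "\<And>n \<omega>. V n \<omega> \<ge> 0" and W_nonneg: "\<And>n \<omega>. W n \<omega> \<ge> 0"
    and a: "\<And>n. a n \<ge> 0" "summable a" and b: "\<And>n. b n \<ge> 0" "summable b"
    and drift: "\<And>n A. A \<in> sets (F n) \<Longrightarrow>
      (\<integral>\<^sup>+\<omega>. indicator A \<omega> * ennreal (V (Suc n) \<omega>) \<partial>M) + (\<integral>\<^sup>+\<omega>. indicator A \<omega> * ennreal (W n \<omega>) \<partial>M)
        \<le> (\<integral>\<^sup>+\<omega>. indicator A \<omega> * ennreal ((1 + a n) * V n \<omega> + b n) \<partial>M)"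
  shows "AE \<omega> in M. convergent (\<lambda>n. V n \<omega>)" and "AE \<omega> in M. summable (\<lambda>n. W n \<omega>)"
proof -
  have sets_M: "A \<in> sets M" if "A \<in> sets (F n)" for A n using sets_F that by blast
  have V_meas [measurable]: "V n \<in> borel_measurable M" for n
    using measurable_mono[OF order_refl refl sets_F space_F, of n borel] V_adapted by blast
  note [measurable] = W_meas
  have total: "(\<integral>\<^sup>+\<omega>. V (Suc n) \<omega> \<partial>M) + (\<integral>\<^sup>+\<omega>. W n \<omega> \<partial>M) \<le> (\<integral>\<^sup>+\<omega>. (1 + a n) * V n \<omega> + b n \<partial>M)" for n
  proof -
    have "(\<integral>\<^sup>+\<omega>. indicator (space M) \<omega> * ennreal (g \<omega>) \<partial>M) = (\<integral>\<^sup>+\<omega>. g \<omega> \<partial>M)" for g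
      by (rule nn_integral_cong) simp
    with drift[of "space M" n] sets.top[of "F n"] show ?thesis by (simp add: space_F)
  qed
  have V_int: "integrable M (V n)" for n
  proof (induction n)
    case (Suc n)
    have "(\<integral>\<^sup>+\<omega>. V (Suc n) \<omega> \<partial>M) \<le> (\<integral>\<^sup>+\<omega>. (1 + a n) * V n \<omega> + b n \<partial>M)"
      using total[of n] by (rule order_trans[rotated]) simp
    also have "\<dots> = ennreal (\<integral>\<omega>. (1 + a n) * V n \<omega> + b n \<partial>M)"
      using Suc V_nonneg a b by (intro nn_integral_eq_integral) auto
    finally show ?case
      using V_nonneg by (intro integrableI_nonneg) (auto simp: top_unique intro: le_less_trans)
  qed (rule V0)
  have step_int: "(\<integral>\<^sup>+\<omega>. indicator A \<omega> * ennreal ((1 + a n) * V n \<omega> + b n) \<partial>M)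
      = ennreal (\<integral>\<omega>. indicator A \<omega> * ((1 + a n) * V n \<omega> + b n) \<partial>M)"
    and step_integrable: "integrable M (\<lambda>\<omega>. indicator A \<omega> * ((1 + a n) * V n \<omega> + b n))"
    if "A \<in> sets M" for A n
  proof -
    show int: "integrable M (\<lambda>\<omega>. indicator A \<omega> * ((1 + a n) * V n \<omega> + b n))"
      using integrable_real_mult_indicator[OF that, of "\<lambda>\<omega>. (1 + a n) * V n \<omega> + b n"] V_int
      by (simp add: mult.commute)
    show "(\<integral>\<^sup>+\<omega>. indicator A \<omega> * ennreal ((1 + a n) * V n \<omega> + b n) \<partial>M)
        = ennreal (\<integral>\<omega>. indicator A \<omega> * ((1 + a n) * V n \<omega> + b n) \<partial>M)"
      using a b V_nonneg
      by (subst nn_integral_eq_integral[OF int, symmetric])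
        (auto intro!: nn_integral_cong simp: indicator_def)
  qed
  define v where "v n = (\<integral>\<omega>. V n \<omega> \<partial>M)" for n
  have v_nonneg: "v n \<ge> 0" for n unfolding v_def using V_nonneg by (intro integral_nonneg_AE) simp
  have W_int: "integrable M (W n)" and v_Suc: "v (Suc n) + (\<integral>\<omega>. W n \<omega> \<partial>M) \<le> (1 + a n) * v n + b n" for n
  proof -
    have rhs: "(\<integral>\<^sup>+\<omega>. (1 + a n) * V n \<omega> + b n \<partial>M) = ennreal ((1 + a n) * v n + b n)"
      using V_nonneg a b V_int
      by (subst nn_integral_eq_integral) (auto simp: v_def prob_space)
    have "(\<integral>\<^sup>+\<omega>. W n \<omega> \<partial>M) \<le> ennreal ((1 + a n) * v n + b n)"
      using total[of n] unfolding rhs by (rule order_trans[rotated]) simp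
    then show W: "integrable M (W n)"
      using W_nonneg by (intro integrableI_nonneg) (auto simp: top_unique intro: le_less_trans)
    have "ennreal (v (Suc n)) + ennreal (\<integral>\<omega>. W n \<omega> \<partial>M) \<le> ennreal ((1 + a n) * v n + b n)"
      using total[of n] unfolding rhs v_def
      by (simp add: nn_integral_eq_integral V_int W V_nonneg W_nonneg)
    then have "ennreal (v (Suc n) + (\<integral>\<omega>. W n \<omega> \<partial>M)) \<le> ennreal ((1 + a n) * v n + b n)"
      using v_nonneg W_nonneg by (simp add: ennreal_plus integral_nonneg_AE)
    then show "v (Suc n) + (\<integral>\<omega>. W n \<omega> \<partial>M) \<le> (1 + a n) * v n + b n"
      using a b v_nonneg by (subst (asm) ennreal_le_iff) auto
  qed
  have W_mean_nonneg: "(\<integral>\<omega>. W n \<omega> \<partial>M) \<ge> 0" for n using W_nonneg by (intro integral_nonneg_AE) simp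
  have "v n \<le> (v 0 + (\<Sum>k<n. b k)) * exp (\<Sum>k<n. a k)" for n
  proof (induction n)
    case (Suc n)
    let ?s = "\<Sum>k<n. b k" and ?t = "\<Sum>k<n. a k"
    have st: "?s \<ge> 0" "?t \<ge> 0" using a b by (auto intro: sum_nonneg)
    have "v (Suc n) \<le> (1 + a n) * v n + b n * 1" using v_Suc[of n] W_mean_nonneg[of n] by linarith
    also have "(1 + a n) * v n \<le> exp (a n) * ((v 0 + ?s) * exp ?t)"
      using Suc a v_nonneg by (intro mult_mono) auto
    also have "b n * 1 \<le> b n * exp (a n + ?t)"
      using b a st by (intro mult_left_mono) auto
    finally show ?case by (simp add: exp_add algebra_simps)
  qed simp
  note v_partial = this
  have v_le: "v n \<le> (v 0 + suminf b) * exp (suminf a)" for n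
  proof (rule order_trans[OF v_partial mult_mono])
    have "(\<Sum>k<n. a k) \<le> suminf a" "(\<Sum>k<n. b k) \<le> suminf b"
      using a b by (auto intro: sum_le_suminf)
    then show "v 0 + (\<Sum>k<n. b k) \<le> v 0 + suminf b" "exp (\<Sum>k<n. a k) \<le> exp (suminf a)" by auto
    show "0 \<le> v 0 + suminf b" using v_nonneg b by (simp add: suminf_nonneg)
  qed simp
  define e where "e n = a n * ((v 0 + suminf b) * exp (suminf a)) + b n" for n
  have e: "e n \<ge> 0" for n
    unfolding e_def using a b v_nonneg[of 0] by (auto intro!: add_nonneg_nonneg mult_nonneg_nonneg suminf_nonneg)
  have e_sum: "summable e" unfolding e_def using a b by (intro summable_add summable_mult2)
  have err: "a n * v n + b n \<le> e n" for n
    unfolding e_def using v_le[of n] a by (intro add_right_mono mult_left_mono) auto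
  show "AE \<omega> in M. convergent (\<lambda>n. V n \<omega>)"
  proof (rule almost_supermartingale_convergent[where F = F and e = e, OF space_F sets_F mono_F V_adapted V_int V_nonneg e e_sum])
    fix n A assume A: "A \<in> sets (F n)"
    then have AM: "A \<in> sets M" by (rule sets_M)
    have AV: "integrable M (\<lambda>\<omega>. indicator A \<omega> * V k \<omega>)" for k
      using integrable_real_mult_indicator[OF AM V_int, of k] by (simp add: mult.commute)
    have "ennreal (\<integral>\<omega>. indicator A \<omega> * V (Suc n) \<omega> \<partial>M) = (\<integral>\<^sup>+\<omega>. indicator A \<omega> * ennreal (V (Suc n) \<omega>) \<partial>M)"
      by (subst nn_integral_eq_integral[OF AV, symmetric])
        (auto intro!: nn_integral_cong simp: indicator_def V_nonneg)
    also have "\<dots> \<le> ennreal (\<integral>\<omega>. indicator A \<omega> * ((1 + a n) * V n \<omega> + b n) \<partial>M)"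
      using drift[OF A] unfolding step_int[OF AM] by (rule order_trans[rotated]) simp
    finally have "(\<integral>\<omega>. indicator A \<omega> * V (Suc n) \<omega> \<partial>M) \<le> (\<integral>\<omega>. indicator A \<omega> * ((1 + a n) * V n \<omega> + b n) \<partial>M)"
      using a b V_nonneg by (subst (asm) ennreal_le_iff) (auto intro!: integral_nonneg_AE)
    also have "\<dots> \<le> (\<integral>\<omega>. indicator A \<omega> * V n \<omega> + (a n * V n \<omega> + b n) \<partial>M)"
      using a b V_nonneg
      by (intro integral_mono step_integrable AM Bochner_Integration.integrable_add AV integrable_mult_right V_int)
        (auto simp: indicator_def algebra_simps)
    also have "\<dots> = (\<integral>\<omega>. indicator A \<omega> * V n \<omega> \<partial>M) + (a n * v n + b n)"
      using AV V_int by (simp add: v_def prob_space)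
    finally show "(\<integral>\<omega>. indicator A \<omega> * V (Suc n) \<omega> \<partial>M) \<le> (\<integral>\<omega>. indicator A \<omega> * V n \<omega> \<partial>M) + e n"
      using err[of n] by linarith
  qed
  have W_sum: "(\<Sum>k<n. \<integral>\<omega>. W k \<omega> \<partial>M) \<le> v 0 + suminf e" for n
  proof -
    have "(\<Sum>k<n. \<integral>\<omega>. W k \<omega> \<partial>M) + v n \<le> v 0 + (\<Sum>k<n. e k)"
    proof (induction n)
      case (Suc n)
      have "v (Suc n) + (\<integral>\<omega>. W n \<omega> \<partial>M) \<le> v n + e n"
        using v_Suc[of n] err[of n] by (simp add: algebra_simps)
      with Suc show ?case by simp
    qed simp
    moreover have "(\<Sum>k<n. e k) \<le> suminf e" using e e_sum by (intro sum_le_suminf) auto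
    ultimately show ?thesis using v_nonneg[of n] by linarith
  qed
  have "(\<integral>\<^sup>+\<omega>. (\<Sum>n. ennreal (W n \<omega>)) \<partial>M) = (\<Sum>n. \<integral>\<^sup>+\<omega>. ennreal (W n \<omega>) \<partial>M)"
    by (rule nn_integral_suminf) simp
  also have "\<dots> = (\<Sum>n. ennreal (\<integral>\<omega>. W n \<omega> \<partial>M))"
    by (simp add: nn_integral_eq_integral W_int W_nonneg)
  also have "\<dots> \<le> ennreal (v 0 + suminf e)"
  proof (rule suminf_le_const)
    show "(\<Sum>k<n. ennreal (\<integral>\<omega>. W k \<omega> \<partial>M)) \<le> ennreal (v 0 + suminf e)" for n
      using W_sum[of n] by (subst sum_ennreal) (auto simp: W_mean_nonneg intro: ennreal_leI)
  qed simp
  finally have "(\<integral>\<^sup>+\<omega>. (\<Sum>n. ennreal (W n \<omega>)) \<partial>M) \<noteq> \<infinity>" by (auto simp: top_unique)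
  then have "AE \<omega> in M. (\<Sum>n. ennreal (W n \<omega>)) \<noteq> \<infinity>"
    by (intro nn_integral_noteq_infinite) auto
  then show "AE \<omega> in M. summable (\<lambda>n. W n \<omega>)"
    by eventually_elim (rule summable_suminf_not_top, auto simp: W_nonneg)
qed

section \<open>Independence of the past\<close>

lemma cylinder_in_vimage_algebra:
  assumes Z: "\<And>i. i \<in> I \<Longrightarrow> Z i \<in> M \<rightarrow>\<^sub>M N"
    and L: "L \<subseteq> I" "finite L" "L \<noteq> {}" and A: "\<And>j. j \<in> L \<Longrightarrow> A j \<in> sets N"
  shows "(\<Inter>j\<in>L. Z j -` A j \<inter> space M)
    \<in> sets (vimage_algebra (space M) (\<lambda>\<omega>. \<lambda>i\<in>I. Z i \<omega>) (PiM I (\<lambda>_. N)))"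
proof -
  have "Z j -` A j \<inter> space M \<in> sets (vimage_algebra (space M) (\<lambda>\<omega>. \<lambda>i\<in>I. Z i \<omega>) (PiM I (\<lambda>_. N)))"
    if j: "j \<in> L" for j
  proof -
    have "(\<lambda>h. h j) \<in> PiM I (\<lambda>_. N) \<rightarrow>\<^sub>M N" using j L by (intro measurable_component_singleton) auto
    from measurable_sets[OF this A[OF j]]
    have "(\<lambda>\<omega>. \<lambda>i\<in>I. Z i \<omega>) -` ((\<lambda>h. h j) -` A j \<inter> space (PiM I (\<lambda>_. N))) \<inter> space M
      \<in> sets (vimage_algebra (space M) (\<lambda>\<omega>. \<lambda>i\<in>I. Z i \<omega>) (PiM I (\<lambda>_. N)))"
      by (rule in_vimage_algebra)
    also have "(\<lambda>\<omega>. \<lambda>i\<in>I. Z i \<omega>) -` ((\<lambda>h. h j) -` A j \<inter> space (PiM I (\<lambda>_. N))) \<inter> space M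
        = Z j -` A j \<inter> space M"
      using j L Z[THEN measurable_space] by (auto simp: space_PiM)
    finally show ?thesis .
  qed
  then show ?thesis using L by (intro sets.finite_INT) auto
qed

lemma (in prob_space) prob_cylinders_factor:
  assumes X: "\<And>i. i \<in> I \<Longrightarrow> X i \<in> M \<rightarrow>\<^sub>M S" and Y: "\<And>i. i \<in> I \<Longrightarrow> Y i \<in> M \<rightarrow>\<^sub>M T"
    and XY: "indep_set
      (sets (vimage_algebra (space M) (\<lambda>\<omega>. \<lambda>i\<in>I. X i \<omega>) (PiM I (\<lambda>_. S))))
      (sets (vimage_algebra (space M) (\<lambda>\<omega>. \<lambda>i\<in>I. Y i \<omega>) (PiM I (\<lambda>_. T))))"
    and L: "L \<subseteq> I" "finite L" "L \<noteq> {}"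
    and A: "\<And>j. j \<in> L \<Longrightarrow> A j \<in> sets S" and B: "\<And>j. j \<in> L \<Longrightarrow> B j \<in> sets T"
  shows "prob ((\<Inter>j\<in>L. X j -` A j \<inter> space M) \<inter> (\<Inter>j\<in>L. Y j -` B j \<inter> space M))
    = prob (\<Inter>j\<in>L. X j -` A j \<inter> space M) * prob (\<Inter>j\<in>L. Y j -` B j \<inter> space M)"
  using XY cylinder_in_vimage_algebra[OF X L A] cylinder_in_vimage_algebra[OF Y L B]
  by (auto simp: indep_sets2_eq)

lemma (in prob_space) distr_Pair_component:
  fixes X :: "'i \<Rightarrow> 'a \<Rightarrow> 'b" and Y :: "'i \<Rightarrow> 'a \<Rightarrow> 'c"
  assumes X: "\<And>i. i \<in> I \<Longrightarrow> X i \<in> M \<rightarrow>\<^sub>M S" and Y: "\<And>i. i \<in> I \<Longrightarrow> Y i \<in> M \<rightarrow>\<^sub>M T"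
    and XY: "indep_set
      (sets (vimage_algebra (space M) (\<lambda>\<omega>. \<lambda>i\<in>I. X i \<omega>) (PiM I (\<lambda>_. S))))
      (sets (vimage_algebra (space M) (\<lambda>\<omega>. \<lambda>i\<in>I. Y i \<omega>) (PiM I (\<lambda>_. T))))"
    and i: "i \<in> I"
  shows "distr M (S \<Otimes>\<^sub>M T) (\<lambda>\<omega>. (X i \<omega>, Y i \<omega>)) = distr M S (X i) \<Otimes>\<^sub>M distr M T (Y i)"
proof (rule pair_measure_eqI[symmetric])
  show "sigma_finite_measure (distr M S (X i))" "sigma_finite_measure (distr M T (Y i))"
    using prob_space_distr[OF X[OF i]] prob_space_distr[OF Y[OF i]]
    by (auto intro: prob_space_imp_sigma_finite)
next
  fix A B assume "A \<in> sets (distr M S (X i))" "B \<in> sets (distr M T (Y i))"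
  then have AB: "A \<in> sets S" "B \<in> sets T" by auto
  have "(\<lambda>\<omega>. (X i \<omega>, Y i \<omega>)) -` (A \<times> B) \<inter> space M = (X i -` A \<inter> space M) \<inter> (Y i -` B \<inter> space M)"
    by auto
  then show "emeasure (distr M S (X i)) A * emeasure (distr M T (Y i)) B
      = emeasure (distr M (S \<Otimes>\<^sub>M T) (\<lambda>\<omega>. (X i \<omega>, Y i \<omega>))) (A \<times> B)"
    using prob_cylinders_factor[OF X Y XY, of "{i}" "\<lambda>_. A" "\<lambda>_. B"] AB i X[OF i] Y[OF i]
    by (simp add: emeasure_distr emeasure_eq_measure ennreal_mult)
qed (auto cong: sets_pair_measure_cong)

text \<open>
  The preimages of measurable rectangles are stable under intersection and generate the events of the
  pair, and on them the probability factors by the three independence hypotheses.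
\<close>

lemma (in prob_space) indep_vars_Pair:
  fixes X :: "'i \<Rightarrow> 'a \<Rightarrow> 'b" and Y :: "'i \<Rightarrow> 'a \<Rightarrow> 'c"
  assumes X: "indep_vars (\<lambda>_. S) X I" and Y: "indep_vars (\<lambda>_. T) Y I"
    and XY: "indep_set
      (sets (vimage_algebra (space M) (\<lambda>\<omega>. \<lambda>i\<in>I. X i \<omega>) (PiM I (\<lambda>_. S))))
      (sets (vimage_algebra (space M) (\<lambda>\<omega>. \<lambda>i\<in>I. Y i \<omega>) (PiM I (\<lambda>_. T))))"
  shows "indep_vars (\<lambda>_. S \<Otimes>\<^sub>M T) (\<lambda>i \<omega>. (X i \<omega>, Y i \<omega>)) I"
proof -
  have Xm: "X i \<in> M \<rightarrow>\<^sub>M S" if "i \<in> I" for i using X that by (auto simp: indep_vars_def)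
  have Ym: "Y i \<in> M \<rightarrow>\<^sub>M T" if "i \<in> I" for i using Y that by (auto simp: indep_vars_def)
  define R where "R i = {(X i -` A \<inter> space M) \<inter> (Y i -` B \<inter> space M) | A B. A \<in> sets S \<and> B \<in> sets T}" for i
  have R_indep: "indep_sets R I"
  proof (rule indep_setsI)
    fix i assume "i \<in> I"
    then show "R i \<subseteq> events" using Xm Ym by (auto simp: R_def)
  next
    fix E L assume L: "L \<noteq> {}" "L \<subseteq> I" "finite L" and E: "\<forall>j\<in>L. E j \<in> R j"
    have "\<forall>j\<in>L. \<exists>AB. fst AB \<in> sets S \<and> snd AB \<in> sets T
        \<and> E j = (X j -` fst AB \<inter> space M) \<inter> (Y j -` snd AB \<inter> space M)"
      using E unfolding R_def by fastforce
    then obtain AB where AB: "\<And>j. j \<in> L \<Longrightarrow> fst (AB j) \<in> sets S" "\<And>j. j \<in> L \<Longrightarrow> snd (AB j) \<in> sets T"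
      "\<And>j. j \<in> L \<Longrightarrow> E j = (X j -` fst (AB j) \<inter> space M) \<inter> (Y j -` snd (AB j) \<inter> space M)"
      by metis
    let ?X = "\<lambda>j. X j -` fst (AB j) \<inter> space M" and ?Y = "\<lambda>j. Y j -` snd (AB j) \<inter> space M"
    have XL: "indep_vars (\<lambda>_. S) X L" and YL: "indep_vars (\<lambda>_. T) Y L"
      using indep_vars_subset[OF X L(2)] indep_vars_subset[OF Y L(2)] .
    note factor = prob_cylinders_factor[OF Xm Ym XY, of _ "\<lambda>j. fst (AB j)" "\<lambda>j. snd (AB j)"]
    have fac: "prob (?X j \<inter> ?Y j) = prob (?X j) * prob (?Y j)" if "j \<in> L" for j
      using factor[of "{j}"] that L AB by auto
    have "\<Inter>(E ` L) = (\<Inter>j\<in>L. ?X j) \<inter> (\<Inter>j\<in>L. ?Y j)"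
      using AB(3) L(1) by auto
    then have "prob (\<Inter>(E ` L)) = prob (\<Inter>j\<in>L. ?X j) * prob (\<Inter>j\<in>L. ?Y j)"
      using factor[of L] L AB by simp
    also have "\<dots> = (\<Prod>j\<in>L. prob (?X j)) * (\<Prod>j\<in>L. prob (?Y j))"
      using indep_varsD_finite[OF XL L(1,3)] indep_varsD_finite[OF YL L(1,3)] AB by simp
    also have "\<dots> = (\<Prod>j\<in>L. prob (E j))"
      using AB fac by (simp add: prod.distrib)
    finally show "prob (\<Inter>(E ` L)) = (\<Prod>j\<in>L. prob (E j))" .
  qed
  have "Int_stable (R i)" for i
  proof (rule Int_stableI)
    fix a b assume "a \<in> R i" "b \<in> R i"
    then obtain A B A' B' where *: "A \<in> sets S" "B \<in> sets T" "A' \<in> sets S" "B' \<in> sets T"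
      "a = (X i -` A \<inter> space M) \<inter> (Y i -` B \<inter> space M)"
      "b = (X i -` A' \<inter> space M) \<inter> (Y i -` B' \<inter> space M)" unfolding R_def by blast
    then have "a \<inter> b = (X i -` (A \<inter> A') \<inter> space M) \<inter> (Y i -` (B \<inter> B') \<inter> space M)" by auto
    then show "a \<inter> b \<in> R i" unfolding R_def using * by blast
  qed
  then have sig: "indep_sets (\<lambda>i. sigma_sets (space M) (R i)) I" by (rule indep_sets_sigma[OF R_indep])
  show ?thesis
    unfolding indep_vars_def2
  proof (intro conjI ballI)
    fix i assume "i \<in> I" then show "(\<lambda>\<omega>. (X i \<omega>, Y i \<omega>)) \<in> M \<rightarrow>\<^sub>M S \<Otimes>\<^sub>M T"
      using Xm Ym by measurable
  next
    show "indep_sets (\<lambda>i. {(\<lambda>\<omega>. (X i \<omega>, Y i \<omega>)) -` A \<inter> space M |A. A \<in> sets (S \<Otimes>\<^sub>M T)}) I"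
    proof (rule indep_sets_mono_sets[OF sig], safe)
      fix i A assume i: "i \<in> I" and A: "A \<in> sets (S \<Otimes>\<^sub>M T)"
      let ?N = "sigma (space M) (R i)"
      have R: "R i \<subseteq> Pow (space M)" by (auto simp: R_def)
      have "(\<lambda>\<omega>. (X i \<omega>, Y i \<omega>)) \<in> ?N \<rightarrow>\<^sub>M S \<Otimes>\<^sub>M T"
      proof (rule measurable_Pair)
        show "X i \<in> ?N \<rightarrow>\<^sub>M S"
        proof (rule measurableI)
          fix A assume "A \<in> sets S"
          then have "(X i -` A \<inter> space M) \<inter> (Y i -` space T \<inter> space M) \<in> R i"
            unfolding R_def by blast
          moreover have "(X i -` A \<inter> space M) \<inter> (Y i -` space T \<inter> space M) = X i -` A \<inter> space M"
            using measurable_space[OF Ym[OF i]] by auto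
          ultimately show "X i -` A \<inter> space ?N \<in> sets ?N" using R by (simp add: space_measure_of sets_measure_of)
        qed (use measurable_space[OF Xm[OF i]] R in \<open>simp add: space_measure_of\<close>)
        show "Y i \<in> ?N \<rightarrow>\<^sub>M T"
        proof (rule measurableI)
          fix B assume "B \<in> sets T"
          then have "(X i -` space S \<inter> space M) \<inter> (Y i -` B \<inter> space M) \<in> R i"
            unfolding R_def by blast
          moreover have "(X i -` space S \<inter> space M) \<inter> (Y i -` B \<inter> space M) = Y i -` B \<inter> space M"
            using measurable_space[OF Xm[OF i]] by auto
          ultimately show "Y i -` B \<inter> space ?N \<in> sets ?N" using R by (simp add: space_measure_of sets_measure_of)
        qed (use measurable_space[OF Ym[OF i]] R in \<open>simp add: space_measure_of\<close>)
      qed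
      from measurable_sets[OF this A] R
      show "(\<lambda>\<omega>. (X i \<omega>, Y i \<omega>)) -` A \<inter> space M \<in> sigma_sets (space M) (R i)"
        by (simp add: space_measure_of sets_measure_of)
    qed
  qed
qed

definition history :: "'w measure \<Rightarrow> 'z measure \<Rightarrow> (nat \<Rightarrow> 'w \<Rightarrow> 'z) \<Rightarrow> nat \<Rightarrow> 'w measure" where
  "history M N Z n = vimage_algebra (space M) (\<lambda>\<omega>. \<lambda>k\<in>{1..n}. Z k \<omega>) (PiM {1..n} (\<lambda>_. N))"

lemma space_history [simp]: "space (history M N Z n) = space M"
  by (simp add: history_def)

lemma measurable_history:
  assumes "\<And>k. k \<ge> 1 \<Longrightarrow> Z k \<in> M \<rightarrow>\<^sub>M N" and "1 \<le> k" "k \<le> n"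
  shows "Z k \<in> history M N Z n \<rightarrow>\<^sub>M N"
proof -
  have "(\<lambda>\<omega>. \<lambda>k\<in>{1..n}. Z k \<omega>) \<in> history M N Z n \<rightarrow>\<^sub>M PiM {1..n} (\<lambda>_. N)"
    unfolding history_def using assms(1)[THEN measurable_space]
    by (intro measurable_vimage_algebra1) (auto simp: space_PiM)
  from measurable_compose[OF this measurable_component_singleton[of k]] assms show ?thesis by simp
qed

lemma sets_history_subset:
  assumes Z: "\<And>k. k \<ge> 1 \<Longrightarrow> Z k \<in> M \<rightarrow>\<^sub>M N"
  shows "sets (history M N Z n) \<subseteq> sets M"
proof -
  have "(\<lambda>\<omega>. \<lambda>k\<in>{1..n}. Z k \<omega>) \<in> M \<rightarrow>\<^sub>M PiM {1..n} (\<lambda>_. N)"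
    using Z by (intro measurable_restrict) auto
  then have "(\<lambda>\<omega>. \<omega>) \<in> M \<rightarrow>\<^sub>M history M N Z n"
    unfolding history_def by (intro measurable_vimage_algebra2) auto
  from measurable_sets[OF this] show ?thesis
    using sets.sets_into_space[of _ "history M N Z n"] by (auto simp: Int_absorb2)
qed

lemma sets_history_mono:
  assumes Z: "\<And>k. k \<ge> 1 \<Longrightarrow> Z k \<in> M \<rightarrow>\<^sub>M N"
  shows "sets (history M N Z n) \<subseteq> sets (history M N Z (Suc n))"
proof -
  have "(\<lambda>\<omega>. \<lambda>k\<in>{1..n}. Z k \<omega>) \<in> history M N Z (Suc n) \<rightarrow>\<^sub>M PiM {1..n} (\<lambda>_. N)"
    using Z by (intro measurable_restrict measurable_history) auto
  then have "(\<lambda>\<omega>. \<omega>) \<in> history M N Z (Suc n) \<rightarrow>\<^sub>M history M N Z n"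
    by (subst (2) history_def) (intro measurable_vimage_algebra2, auto)
  from measurable_sets[OF this] show ?thesis
    using sets.sets_into_space[of _ "history M N Z n"] by (auto simp: Int_absorb2)
qed

text \<open>
  The joint law of a variable of the past and the next variable is a product measure, so Tonelli's theorem
  allows integrating over the next variable while the past is frozen.
\<close>

lemma (in prob_space) nn_integral_freeze_history:
  fixes Z :: "nat \<Rightarrow> 'a \<Rightarrow> 'z"
  assumes Z: "indep_vars (\<lambda>_. N) Z {1..}"
    and G: "G \<in> history M N Z n \<rightarrow>\<^sub>M S"
    and h: "h \<in> borel_measurable (S \<Otimes>\<^sub>M N)"
  shows "(\<integral>\<^sup>+\<omega>. h (G \<omega>, Z (Suc n) \<omega>) \<partial>M)
    = (\<integral>\<^sup>+\<omega>. (\<integral>\<^sup>+z. h (G \<omega>, z) \<partial>distr M N (Z (Suc n))) \<partial>M)"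
proof -
  have Zm: "Z k \<in> M \<rightarrow>\<^sub>M N" if "k \<ge> 1" for k using Z that by (auto simp: indep_vars_def)
  have Gm: "G \<in> M \<rightarrow>\<^sub>M S"
    using measurable_mono[of S S "history M N Z n" M] sets_history_subset[of Z M N n, OF Zm] G by auto
  note indep = indep_var_restrict[OF Z, of "{1..n}" "{Suc n}"]
  have factor: "prob ((G -` A \<inter> space M) \<inter> (Z (Suc n) -` B \<inter> space M))
      = prob (G -` A \<inter> space M) * prob (Z (Suc n) -` B \<inter> space M)"
    if A: "A \<in> sets S" and B: "B \<in> sets N" for A B
  proof -
    let ?X = "\<lambda>\<omega>. \<lambda>k\<in>{1..n}. Z k \<omega>" and ?Y = "\<lambda>\<omega>. \<lambda>k\<in>{Suc n}. Z k \<omega>"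
    have "G -` A \<inter> space M \<in> sigma_sets (space M) {?X -` A \<inter> space M | A. A \<in> sets (PiM {1..n} (\<lambda>_. N))}"
      using measurable_sets[OF G A] by (simp add: history_def sets_vimage_algebra)
    moreover
    let ?B = "(\<lambda>h. h (Suc n)) -` B \<inter> space (PiM {Suc n} (\<lambda>_. N))"
    have "?B \<in> sets (PiM {Suc n} (\<lambda>_. N))"
      using measurable_sets[of "\<lambda>h. h (Suc n)" "PiM {Suc n} (\<lambda>_. N)" N B]
        measurable_component_singleton[of "Suc n" "{Suc n}" "\<lambda>_. N"] B by simp
    then have "?Y -` ?B \<inter> space M \<in> sigma_sets (space M) {?Y -` A \<inter> space M | A. A \<in> sets (PiM {Suc n} (\<lambda>_. N))}"
      by blast
    moreover have "?Y -` ?B \<inter> space M = Z (Suc n) -` B \<inter> space M"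
      using measurable_space[OF Zm[of "Suc n"]] by (auto simp: space_PiM)
    ultimately show ?thesis using indep by (auto simp: indep_var_eq indep_sets2_eq)
  qed
  interpret Q: prob_space "distr M N (Z (Suc n))" by (rule prob_space_distr) (simp add: Zm)
  interpret QG: prob_space "distr M S G" by (rule prob_space_distr) (rule Gm)
  have joint: "distr M S G \<Otimes>\<^sub>M distr M N (Z (Suc n)) = distr M (S \<Otimes>\<^sub>M N) (\<lambda>\<omega>. (G \<omega>, Z (Suc n) \<omega>))"
  proof (rule pair_measure_eqI)
    fix A B assume "A \<in> sets (distr M S G)" "B \<in> sets (distr M N (Z (Suc n)))"
    then have AB: "A \<in> sets S" "B \<in> sets N" by auto
    have "(\<lambda>\<omega>. (G \<omega>, Z (Suc n) \<omega>)) -` (A \<times> B) \<inter> space M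
        = (G -` A \<inter> space M) \<inter> (Z (Suc n) -` B \<inter> space M)" by auto
    then show "emeasure (distr M S G) A * emeasure (distr M N (Z (Suc n))) B
        = emeasure (distr M (S \<Otimes>\<^sub>M N) (\<lambda>\<omega>. (G \<omega>, Z (Suc n) \<omega>))) (A \<times> B)"
      using AB Gm Zm[of "Suc n"] factor[OF AB]
      by (simp add: emeasure_distr emeasure_eq_measure ennreal_mult)
  qed (auto intro: Q.sigma_finite_measure_axioms QG.sigma_finite_measure_axioms cong: sets_pair_measure_cong)
  have hm: "h \<in> borel_measurable (S \<Otimes>\<^sub>M distr M N (Z (Suc n)))"
    using h by (simp cong: measurable_cong_sets sets_pair_measure_cong)
  have "(\<integral>\<^sup>+\<omega>. h (G \<omega>, Z (Suc n) \<omega>) \<partial>M) = (\<integral>\<^sup>+v. h v \<partial>distr M (S \<Otimes>\<^sub>M N) (\<lambda>\<omega>. (G \<omega>, Z (Suc n) \<omega>)))"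
    using Gm Zm[of "Suc n"] h by (subst nn_integral_distr) auto
  also have "\<dots> = (\<integral>\<^sup>+x. (\<integral>\<^sup>+z. h (x, z) \<partial>distr M N (Z (Suc n))) \<partial>distr M S G)"
    unfolding joint[symmetric] using hm
    by (intro Q.nn_integral_fst[symmetric]) (simp cong: measurable_cong_sets sets_pair_measure_cong)
  also have "\<dots> = (\<integral>\<^sup>+\<omega>. (\<integral>\<^sup>+z. h (G \<omega>, z) \<partial>distr M N (Z (Suc n))) \<partial>M)"
    by (rule nn_integral_distr[OF Gm]) (use Q.borel_measurable_nn_integral_fst[OF hm] in simp)
  finally show ?thesis .
qed

section \<open>Convergence of weighted averages\<close>

lemma weighted_average_tendsto:
  fixes l :: "nat \<Rightarrow> real" and c :: "nat \<Rightarrow> real"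
  assumes l: "\<And>n. l n > 0" and l_sum: "filterlim (\<lambda>n. \<Sum>k=1..n. l k) at_top sequentially"
    and c: "c \<longlonglongrightarrow> L"
  shows "weighted_average l c \<longlonglongrightarrow> L"
proof (rule LIMSEQ_I)
  fix r :: real assume r: "r > 0"
  define s where "s n = (\<Sum>k=1..n. l k)" for n
  obtain N where N: "\<And>n. n \<ge> N \<Longrightarrow> norm (c n - L) < r / 2"
    using LIMSEQ_D[OF c, of "r / 2"] r by auto
  define B where "B = (\<Sum>k=1..N. l k * \<bar>c k - L\<bar>)"
  have "\<forall>\<^sub>F n in sequentially. s n \<ge> 2 * B / r + 1"
    using l_sum unfolding filterlim_at_top s_def by blast
  then obtain N' where N': "\<And>n. n \<ge> N' \<Longrightarrow> s n \<ge> 2 * B / r + 1"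
    by (auto simp: eventually_sequentially)
  have "norm (weighted_average l c n - L) < r" if n: "n \<ge> max N N'" for n
  proof -
    have B: "B \<ge> 0" unfolding B_def using l by (intro sum_nonneg) (simp add: less_imp_le)
    have "s n \<ge> 2 * B / r + 1" using N' n by simp
    moreover have "2 * B / r \<ge> 0" using B r by simp
    ultimately have s: "s n > 0" "s n > 2 * B / r" by linarith+
    then have Bs: "2 * B < r * s n" using r by (simp add: field_simps)
    have "weighted_average l c n - L = (\<Sum>k=1..n. l k * (c k - L)) / s n"
      using s unfolding weighted_average_def s_def[symmetric]
      by (simp add: right_diff_distrib sum_subtractf sum_distrib_right[symmetric] s_def diff_divide_distrib
          divide_inverse_commute)
    also have "\<bar>\<dots>\<bar> \<le> (\<Sum>k=1..n. l k * \<bar>c k - L\<bar>) / s n"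
    proof -
      have "\<bar>\<Sum>k=1..n. l k * (c k - L)\<bar> \<le> (\<Sum>k=1..n. l k * \<bar>c k - L\<bar>)"
        by (rule order_trans[OF sum_abs]) (simp add: abs_mult l less_imp_le)
      then show ?thesis using s by (simp add: divide_right_mono)
    qed
    also have "(\<Sum>k=1..n. l k * \<bar>c k - L\<bar>) \<le> B + (r / 2) * s n"
    proof -
      have "(\<Sum>k=1..n. l k * \<bar>c k - L\<bar>)
          \<le> (\<Sum>k=1..n. (if k \<le> N then l k * \<bar>c k - L\<bar> else 0) + (r / 2) * l k)"
      proof (rule sum_mono)
        fix k
        show "l k * \<bar>c k - L\<bar> \<le> (if k \<le> N then l k * \<bar>c k - L\<bar> else 0) + (r / 2) * l k"
          using N[of k] l[of k] r by (cases "k \<le> N") (auto simp: mult.commute less_imp_le intro: mult_left_mono)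
      qed
      also have "\<dots> = (\<Sum>k\<in>{1..n} \<inter> {..N}. l k * \<bar>c k - L\<bar>) + (r / 2) * s n"
        unfolding s_def sum.distrib sum_distrib_left 
        using sum.inter_restrict[of "{1..n}" "\<lambda>k. l k * \<bar>c k - L\<bar>" "{..N}"] by simp
      also have "{1..n} \<inter> {..N} = {1..N}" using n by auto
      finally show ?thesis unfolding B_def .
    qed
    finally have "\<bar>weighted_average l c n - L\<bar> \<le> (B + (r / 2) * s n) / s n"
      using s by (simp add: divide_right_mono)
    also have "\<dots> < r" using s Bs by (simp add: field_simps)
    finally show ?thesis by simp
  qed
  then show "\<exists>no. \<forall>n\<ge>no. norm (weighted_average l c n - L) < r" by blast
qed

lemma inner_weighted_average:
  "inner (weighted_average l x n) v = weighted_average l (\<lambda>k. inner (x k) v) n"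
  by (simp add: weighted_average_def inner_sum_left)

lemma weighted_average_Jensen:
  assumes g: "convex_on UNIV g" and l: "\<And>n. l n > 0" and n: "n \<ge> 1"
  shows "g (weighted_average l x n) \<le> weighted_average l (\<lambda>k. g (x k)) n"
proof -
  define s where "s = (\<Sum>k=1..n. l k)"
  have s: "s > 0" unfolding s_def using l n by (intro sum_pos) auto
  have "weighted_average l x n = (\<Sum>k=1..n. (l k / s) *\<^sub>R x k)"
    unfolding weighted_average_def s_def[symmetric] by (simp add: scaleR_sum_right divide_inverse mult.commute)
  also have "g \<dots> \<le> (\<Sum>k=1..n. (l k / s) * g (x k))"
  proof (rule convex_on_sum[OF _ _ g])
    show "(\<Sum>k=1..n. l k / s) = 1" using s by (simp add: sum_divide_distrib[symmetric] s_def)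
  qed (use l s n in \<open>auto simp: less_imp_le\<close>)
  also have "\<dots> = weighted_average l (\<lambda>k. g (x k)) n"
    unfolding weighted_average_def s_def[symmetric] by (simp add: sum_distrib_left divide_inverse ac_simps)
  finally show ?thesis .
qed

text \<open>
  If \<open>u\<close> and \<open>v\<close> are two cluster points of the averages, then the averages of the convergent sequence
  \<open>inner (x k) (u - v)\<close> have the two limits \<open>inner u (u - v)\<close> and \<open>inner v (u - v)\<close>, so \<open>u = v\<close>.
\<close>

lemma weighted_average_converges_in:
  fixes x :: "nat \<Rightarrow> 'a::euclidean_space"
  assumes l: "\<And>n. l n > 0" and l_sum: "filterlim (\<lambda>n. \<Sum>k=1..n. l k) at_top sequentially"
    and bdd: "bounded (range (weighted_average l x))"
    and cluster: "\<And>r u. strict_mono r \<Longrightarrow> (\<lambda>n. weighted_average l x (r n)) \<longlonglongrightarrow> u \<Longrightarrow> u \<in> S"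
    and inner: "\<And>u v. u \<in> S \<Longrightarrow> v \<in> S \<Longrightarrow> convergent (\<lambda>n. inner (x n) (u - v))"
  shows "\<exists>u\<in>S. weighted_average l x \<longlonglongrightarrow> u"
proof -
  let ?a = "weighted_average l x"
  have sub: "\<exists>u r. strict_mono r \<and> (\<lambda>n. ?a (q (r n))) \<longlonglongrightarrow> u" for q :: "nat \<Rightarrow> nat"
  proof -
    have "bounded (range (\<lambda>n. ?a (q n)))" by (rule bounded_subset[OF bdd]) auto
    from bounded_imp_convergent_subsequence[OF this] show ?thesis by (auto simp: comp_def)
  qed
  obtain u r where r: "strict_mono r" "(\<lambda>n. ?a (r n)) \<longlonglongrightarrow> u" using sub[of "\<lambda>n. n"] by auto
  then have uS: "u \<in> S" by (rule cluster)
  have "?a \<longlonglongrightarrow> u"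
  proof (rule ccontr)
    assume "\<not> ?a \<longlonglongrightarrow> u"
    then obtain e where e: "e > 0" "\<And>N. \<exists>n\<ge>N. dist (?a n) u \<ge> e"
      unfolding lim_sequentially by (auto simp: not_less)
    then have "infinite {n. dist (?a n) u \<ge> e}"
      unfolding infinite_nat_iff_unbounded_le by auto
    then obtain q :: "nat \<Rightarrow> nat" where "strict_mono q" "\<forall>n. q n \<in> {n. dist (?a n) u \<ge> e}"
      using infinite_enumerate by blast
    then have q: "strict_mono q" "\<And>n. dist (?a (q n)) u \<ge> e" by auto
    obtain v t where t: "strict_mono t" "(\<lambda>n. ?a (q (t n))) \<longlonglongrightarrow> v" using sub by blast
    have qt: "strict_mono (\<lambda>n. q (t n))" using q t by (simp add: strict_mono_def)
    have vS: "v \<in> S" using cluster[OF qt t(2)] .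
    have "dist v u \<ge> e"
      by (rule tendsto_lowerbound[OF tendsto_dist[OF t(2) tendsto_const]]) (use q in auto)
    then have "u \<noteq> v" using e(1) by auto
    obtain L where "(\<lambda>n. inner (x n) (u - v)) \<longlonglongrightarrow> L" using inner[OF uS vS] by (auto simp: convergent_def)
    then have "(\<lambda>n. inner (?a n) (u - v)) \<longlonglongrightarrow> L"
      unfolding inner_weighted_average by (rule weighted_average_tendsto[OF l l_sum])
    then have "(\<lambda>n. inner (?a (r n)) (u - v)) \<longlonglongrightarrow> L" "(\<lambda>n. inner (?a (q (t n))) (u - v)) \<longlonglongrightarrow> L"
      using LIMSEQ_subseq_LIMSEQ[OF _ r(1)] LIMSEQ_subseq_LIMSEQ[OF _ qt] by (auto simp: comp_def)
    moreover have "(\<lambda>n. inner (?a (r n)) (u - v)) \<longlonglongrightarrow> inner u (u - v)"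
      "(\<lambda>n. inner (?a (q (t n))) (u - v)) \<longlonglongrightarrow> inner v (u - v)"
      using r(2) t(2) by (auto intro!: tendsto_intros)
    ultimately have "inner u (u - v) = inner v (u - v)" using LIMSEQ_unique by metis
    then have "inner (u - v) (u - v) = 0" by (simp add: inner_diff_left)
    with \<open>u \<noteq> v\<close> show False by simp
  qed
  with uS show ?thesis by blast
qed

section \<open>The random splitting iteration\<close>

lemma nn_integral_finite_space:
  assumes "finite A" and sets: "sets \<nu> = Pow A"
  shows "(\<integral>\<^sup>+j. g j \<partial>\<nu>) = (\<Sum>i\<in>A. g i * emeasure \<nu> {i})"
proof -
  have space: "space \<nu> = A" using sets sets_eq_imp_space_eq[of \<nu> "count_space A"] by simp
  have "(\<integral>\<^sup>+j. g j \<partial>\<nu>) = (\<integral>\<^sup>+j. (\<Sum>i\<in>A. g i * indicator {i} j) \<partial>\<nu>)"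
    using \<open>finite A\<close> by (intro nn_integral_cong) (simp add: space indicator_def if_distrib[of "(*) _"] cong: if_cong)
  also have "\<dots> = (\<Sum>i\<in>A. \<integral>\<^sup>+j. g i * indicator {i} j \<partial>\<nu>)"
    using sets
    by (intro nn_integral_sum borel_measurable_times_ennreal borel_measurable_const borel_measurable_indicator) auto
  also have "\<dots> = (\<Sum>i\<in>A. g i * emeasure \<nu> {i})"
    using sets by (intro sum.cong refl nn_integral_cmult_indicator) auto
  finally show ?thesis .
qed

locale random_splitting = prob_space P for P :: "'w measure" +
  fixes \<mu> :: "'e measure" and f :: "'e \<Rightarrow> 'a::euclidean_space \<Rightarrow> real"
    and m :: nat and X :: "nat \<Rightarrow> 'a set" and l :: "nat \<Rightarrow> real"
    and \<xi> :: "nat \<Rightarrow> 'w \<Rightarrow> 'e" and J :: "nat \<Rightarrow> 'w \<Rightarrow> nat"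
    and p :: nat and C :: "'e \<Rightarrow> real" and x0 :: 'a
  assumes mu: "prob_space \<mu>"
    and m: "m \<ge> 1"
    and X: "\<And>i. i \<in> {1..m} \<Longrightarrow> X i \<noteq> {} \<and> closed (X i) \<and> convex (X i)"
    and l_pos: "\<And>n. l n > 0"
    and l_sum: "filterlim (\<lambda>n. \<Sum>k<n. l k) at_top sequentially"
    and l_square_sum: "summable (\<lambda>n. (l n)\<^sup>2)"
    and xi_indep: "indep_vars (\<lambda>_. \<mu>) \<xi> {1..}"
    and xi_distr: "\<And>n. n \<ge> 1 \<Longrightarrow> distr P \<mu> (\<xi> n) = \<mu>"
    and regular: "boundedly_linearly_regular m X"
    and f_normal: "normal_convex_integrand \<mu> f"
    and f_int: "\<And>x. integrable \<mu> (\<lambda>s. f s x)"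
    and C: "in_Lp \<mu> 2 C"
    and growth: "\<And>x. AE s in \<mu>. norm (min_norm_subgradient (f s) x) \<le> C s * (1 + norm x ^ p)"
    and J_indep: "indep_vars (\<lambda>_. count_space {0..m}) J {1..}"
    and J_ident: "\<And>n. n \<ge> 1 \<Longrightarrow> distr P (count_space {0..m}) (J n) = distr P (count_space {0..m}) (J 1)"
    and J_pos: "\<And>i. i \<in> {0..m} \<Longrightarrow> prob {\<omega> \<in> space P. J 1 \<omega> = i} > 0"
    and J_xi_indep: "indep_set
      (sets (vimage_algebra (space P) (\<lambda>\<omega>. \<lambda>n\<in>{1..}. \<xi> n \<omega>) (PiM {1..} (\<lambda>_. \<mu>))))
      (sets (vimage_algebra (space P) (\<lambda>\<omega>. \<lambda>n\<in>{1..}. J n \<omega>) (PiM {1..} (\<lambda>_. count_space {0..m}))))"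
begin

interpretation mu: prob_space \<mu> by (rule mu)

abbreviation noise :: "('e \<times> nat) measure" where
  "noise \<equiv> \<mu> \<Otimes>\<^sub>M count_space {0..m}"

abbreviation Z :: "nat \<Rightarrow> 'w \<Rightarrow> 'e \<times> nat" where
  "Z n \<omega> \<equiv> (\<xi> n \<omega>, J n \<omega>)"

abbreviation past :: "nat \<Rightarrow> 'w measure" where
  "past \<equiv> history P noise Z"

abbreviation x :: "nat \<Rightarrow> 'w \<Rightarrow> 'a" where
  "x n \<omega> \<equiv> iterate f X l \<xi> J x0 n \<omega>"

abbreviation total_dist :: "'a \<Rightarrow> real" where
  "total_dist y \<equiv> \<Sum>i=1..m. infdist y (X i)"

definition weight :: "nat \<Rightarrow> real" where
  "weight i = prob {\<omega> \<in> space P. J 1 \<omega> = i}"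

definition step :: "nat \<Rightarrow> 'a \<Rightarrow> 'e \<times> nat \<Rightarrow> 'a" where
  "step n y v = (if snd v = 0 then prox (l n) (f (fst v)) y else closest_point (X (snd v)) y)"

lemma x_Suc: "x (Suc n) \<omega> = step n (x n \<omega>) (Z (Suc n) \<omega>)"
  by (simp add: step_def)

lemma xi_measurable: "n \<ge> 1 \<Longrightarrow> \<xi> n \<in> P \<rightarrow>\<^sub>M \<mu>"
  using xi_indep by (simp add: indep_vars_def)

lemma J_measurable: "n \<ge> 1 \<Longrightarrow> J n \<in> P \<rightarrow>\<^sub>M count_space {0..m}"
  using J_indep by (simp add: indep_vars_def)

lemma Z_indep: "indep_vars (\<lambda>_. noise) Z {1..}"
  by (rule indep_vars_Pair[OF xi_indep J_indep J_xi_indep])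

lemma Z_measurable: "n \<ge> 1 \<Longrightarrow> Z n \<in> P \<rightarrow>\<^sub>M noise"
  using xi_measurable J_measurable by simp

lemma measurable_step: "(\<lambda>(y, v). step n y v) \<in> borel_measurable (borel \<Otimes>\<^sub>M noise)"
proof -
  let ?g = "\<lambda>j w. if j = 0 then prox (l n) (f (fst (snd w))) (fst w) else closest_point (X j) (fst w)"
  have "(\<lambda>w. ?g (snd (snd w)) w) \<in> borel_measurable (borel \<Otimes>\<^sub>M noise)"
  proof (rule measurable_compose_countable'[where I = "{0..m}"])
    fix j assume j: "j \<in> {0..m}"
    have 1: "(\<lambda>w. (fst (snd w), fst w)) \<in> (borel :: 'a measure) \<Otimes>\<^sub>M noise \<rightarrow>\<^sub>M \<mu> \<Otimes>\<^sub>M borel"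
      by simp
    have 2: "(\<lambda>w. prox (l n) (f (fst (snd w))) (fst w)) \<in> borel_measurable (borel \<Otimes>\<^sub>M noise)"
      using measurable_compose[OF 1 measurable_prox[OF f_normal l_pos]] by simp
    have 3: "(\<lambda>w. closest_point (X j) (fst w)) \<in> borel_measurable (borel \<Otimes>\<^sub>M noise)" if "j \<noteq> 0"
    proof -
      have "continuous_on UNIV (closest_point (X j))"
        using X[of j] j that by (intro continuous_on_closest_point) auto
      then show ?thesis by (intro measurable_compose[OF measurable_fst borel_measurable_continuous_onI])
    qed
    show "(\<lambda>w. ?g j w) \<in> borel_measurable (borel \<Otimes>\<^sub>M noise)"
      using 2 3 by (cases "j = 0") auto
  qed auto
  then show ?thesis by (simp add: step_def case_prod_beta')
qed

lemma x_adapted: "x n \<in> borel_measurable (past n)"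
proof (induction n)
  case (Suc n)
  have "sets (past n) \<subseteq> sets (past (Suc n))"
    by (rule sets_history_mono) (rule Z_measurable)
  then have "x n \<in> borel_measurable (past (Suc n))"
    using measurable_mono[OF order_refl refl, of "past n" "past (Suc n)" borel] Suc by auto
  moreover have "Z (Suc n) \<in> past (Suc n) \<rightarrow>\<^sub>M noise"
    by (rule measurable_history) (auto intro: Z_measurable)
  ultimately have "(\<lambda>\<omega>. (x n \<omega>, Z (Suc n) \<omega>)) \<in> past (Suc n) \<rightarrow>\<^sub>M borel \<Otimes>\<^sub>M noise"
    by (rule measurable_Pair)
  from measurable_compose[OF this measurable_step[of n]]
  show ?case by (simp only: x_Suc prod.case)
qed simp

lemma weight_pos: "i \<in> {0..m} \<Longrightarrow> weight i > 0"
  unfolding weight_def by (rule J_pos)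

lemma weight_le_1: "weight i \<le> 1"
  unfolding weight_def by simp

lemma J_event: "i \<in> {0..m} \<Longrightarrow> {\<omega> \<in> space P. J 1 \<omega> = i} \<in> events"
  using measurable_sets[OF J_measurable[of 1], of "{i}"] by (simp add: vimage_def Int_def conj_commute)

lemma sum_weight: "(\<Sum>i=0..m. weight i) = 1"
proof -
  have "(\<Sum>i=0..m. weight i) = prob (\<Union>i\<in>{0..m}. {\<omega> \<in> space P. J 1 \<omega> = i})"
    unfolding weight_def
    by (rule finite_measure_finite_Union[symmetric])
      (use J_event in \<open>auto simp: disjoint_family_on_def\<close>)
  also have "(\<Union>i\<in>{0..m}. {\<omega> \<in> space P. J 1 \<omega> = i}) = space P"
    using measurable_space[OF J_measurable[of 1]] by auto
  finally show ?thesis by (simp add: prob_space)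
qed

lemma nn_integral_next_noise:
  assumes h: "h \<in> borel_measurable noise"
  shows "(\<integral>\<^sup>+v. h v \<partial>distr P noise (Z (Suc n))) = (\<Sum>i=0..m. (\<integral>\<^sup>+s. h (s, i) \<partial>\<mu>) * ennreal (weight i))"
proof -
  let ?\<nu> = "distr P (count_space {0..m}) (J 1)"
  interpret nu: prob_space ?\<nu> by (rule prob_space_distr) (simp add: J_measurable)
  interpret pair_sigma_finite \<mu> ?\<nu> ..
  have "distr P noise (Z (Suc n)) = \<mu> \<Otimes>\<^sub>M ?\<nu>"
    using distr_Pair_component[OF xi_measurable J_measurable J_xi_indep, of "Suc n"]
      xi_distr[of "Suc n"] J_ident[of "Suc n"] by simp
  moreover have hm: "(\<lambda>(s, j). h (s, j)) \<in> borel_measurable (\<mu> \<Otimes>\<^sub>M ?\<nu>)"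
    using h by (simp cong: measurable_cong_sets sets_pair_measure_cong)
  ultimately have "(\<integral>\<^sup>+v. h v \<partial>distr P noise (Z (Suc n))) = (\<integral>\<^sup>+j. \<integral>\<^sup>+s. h (s, j) \<partial>\<mu> \<partial>?\<nu>)"
    using nn_integral_snd[OF hm] by simp
  also have "\<dots> = (\<Sum>i=0..m. (\<integral>\<^sup>+s. h (s, i) \<partial>\<mu>) * emeasure ?\<nu> {i})"
    by (rule nn_integral_finite_space) auto
  also have "\<dots> = (\<Sum>i=0..m. (\<integral>\<^sup>+s. h (s, i) \<partial>\<mu>) * ennreal (weight i))"
  proof (rule sum.cong[OF refl])
    fix i assume i: "i \<in> {0..m}"
    have "emeasure ?\<nu> {i} = emeasure P {\<omega> \<in> space P. J 1 \<omega> = i}"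
      using i J_measurable[of 1] by (simp add: emeasure_distr vimage_def Int_def conj_commute)
    then show "(\<integral>\<^sup>+s. h (s, i) \<partial>\<mu>) * emeasure ?\<nu> {i} = (\<integral>\<^sup>+s. h (s, i) \<partial>\<mu>) * ennreal (weight i)"
      by (simp add: emeasure_eq_measure weight_def)
  qed
  finally show ?thesis .
qed

section \<open>Mean decrease of the distance to a solution\<close>

text \<open>
  Conditioning on the index, a proximal step contributes the mean envelope and a projection the squared
  distance to the chosen set; the coefficient of \<open>(norm (y - z))\<^sup>2\<close> is the total weight \<open>1\<close>.
\<close>

lemma mean_step_le:
  assumes z: "z \<in> (\<Inter>i\<in>{1..m}. X i)"
  defines "R \<equiv> \<lambda>n y. (norm (y - z))\<^sup>2
      - 2 * weight 0 * (mean_envelope \<mu> f (l n) y - l n * objective \<mu> f z)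
      - (\<Sum>i=1..m. weight i * (infdist y (X i))\<^sup>2)"
  shows "R n y \<ge> 0"
    and "(\<integral>\<^sup>+v. ennreal ((norm (step n y v - z))\<^sup>2) \<partial>distr P noise (Z (Suc n))) \<le> ennreal (R n y)"
proof -
  let ?psi = "mean_envelope \<mu> f (l n) y"
  define r where "r j = (if j = 0 then (norm (y - z))\<^sup>2 - 2 * (?psi - l n * objective \<mu> f z)
      else (norm (y - z))\<^sup>2 - (infdist y (X j))\<^sup>2)" for j
  have bound: "0 \<le> r j \<and> (\<integral>\<^sup>+s. ennreal ((norm (step n y (s, j) - z))\<^sup>2) \<partial>\<mu>) \<le> ennreal (r j)"
    if j: "j \<in> {0..m}" for j
  proof (cases "j = 0")
    case True
    let ?g = "\<lambda>s. (norm (y - z))\<^sup>2 - 2 * (scaled_envelope (l n) (f s) y - l n * f s z)"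
    note env_int = integrable_scaled_envelope[OF f_normal l_pos f_int growth C]
    have g: "(norm (prox (l n) (f s) y - z))\<^sup>2 \<le> ?g s" if "s \<in> space \<mu>" for s
      by (rule prox_step_le[OF normal_convex_integrandD(2)[OF f_normal that] l_pos])
    then have g0: "AE s in \<mu>. 0 \<le> ?g s" by (intro AE_I2) (meson order_trans zero_le_power2)
    have g_int: "integrable \<mu> ?g" using env_int f_int by simp
    have r: "r j = (\<integral>s. ?g s \<partial>\<mu>)"
      using env_int f_int True
      by (simp add: r_def mean_envelope_def objective_def mu.prob_space)
    have "(\<integral>\<^sup>+s. ennreal ((norm (step n y (s, j) - z))\<^sup>2) \<partial>\<mu>) \<le> (\<integral>\<^sup>+s. ennreal (?g s) \<partial>\<mu>)"
      using g True by (intro nn_integral_mono ennreal_leI) (simp add: step_def)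
    also have "\<dots> = ennreal (r j)" unfolding r by (rule nn_integral_eq_integral[OF g_int g0])
    finally show ?thesis using g0 unfolding r by (auto intro: integral_nonneg_AE)
  next
    case False
    have "(norm (closest_point (X j) y - z))\<^sup>2 \<le> r j"
      using X[of j] j False z by (simp add: r_def closest_point_step_le)
    moreover from this have "0 \<le> r j" by (meson order_trans zero_le_power2)
    ultimately show ?thesis
      using False by (simp add: step_def mu.emeasure_space_1 ennreal_leI)
  qed
  have R: "R n y = (\<Sum>j=0..m. r j * weight j)"
  proof -
    have "(\<Sum>j=0..m. r j * weight j) = r 0 * weight 0 + (\<Sum>j=1..m. r j * weight j)"
      by (simp add: sum.atLeast_Suc_atMost)
    also have "(\<Sum>j=1..m. r j * weight j)
        = (norm (y - z))\<^sup>2 * (\<Sum>j=1..m. weight j) - (\<Sum>j=1..m. weight j * (infdist y (X j))\<^sup>2)"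
      unfolding sum_distrib_left sum_subtractf[symmetric] by (rule sum.cong) (auto simp: r_def algebra_simps)
    also have "(\<Sum>j=1..m. weight j) = 1 - weight 0"
      using sum_weight by (simp add: sum.atLeast_Suc_atMost)
    finally show ?thesis by (simp add: R_def r_def algebra_simps)
  qed
  show "R n y \<ge> 0" unfolding R using bound weight_pos by (intro sum_nonneg mult_nonneg_nonneg) (auto simp: less_imp_le)
  have "(\<lambda>v. step n y v) \<in> borel_measurable noise"
    using measurable_compose[OF measurable_Pair1' measurable_step[of n], of y] by simp
  then have "(\<integral>\<^sup>+v. ennreal ((norm (step n y v - z))\<^sup>2) \<partial>distr P noise (Z (Suc n)))
      = (\<Sum>j=0..m. (\<integral>\<^sup>+s. ennreal ((norm (step n y (s, j) - z))\<^sup>2) \<partial>\<mu>) * ennreal (weight j))"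
    by (intro nn_integral_next_noise) simp
  also have "\<dots> \<le> (\<Sum>j=0..m. ennreal (r j) * ennreal (weight j))"
    using bound by (intro sum_mono mult_right_mono) auto
  also have "\<dots> = ennreal (R n y)"
    unfolding R using bound weight_pos
    by (subst sum_ennreal[symmetric]) (auto simp: ennreal_mult less_imp_le intro!: sum.cong)
  finally show "(\<integral>\<^sup>+v. ennreal ((norm (step n y v - z))\<^sup>2) \<partial>distr P noise (Z (Suc n))) \<le> ennreal (R n y)" .
qed

text \<open>
  The penalty term \<open>(K + 1) * total_dist y\<close> is added to make the decrease \<open>U\<close> nonnegative, and is paid
  for by the mean squared distances in \<open>mean_step_le\<close>: for each set,
  \<open>2 * l * (K + 1) * d - weight i * d\<^sup>2\<close> is at most a multiple of \<open>l\<^sup>2\<close>. The penalty parameter \<open>K + 1\<close>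
  instead of \<open>K\<close> makes a vanishing gap imply feasibility.
\<close>

lemma mean_decrease:
  assumes sol: "is_solution \<mu> f m X z"
  obtains K a U where "K \<ge> 0" "a \<ge> 0"
    and "\<And>y. objective \<mu> f y + K * total_dist y \<ge> objective \<mu> f z"
    and "\<And>n y. U n y \<ge> 0" "\<And>n. U n \<in> borel_measurable borel"
    and "\<And>n y. 0 \<le> (1 + a * (l n)\<^sup>2) * (norm (y - z))\<^sup>2 + a * (l n)\<^sup>2 - U n y"
    and "\<And>n y. (\<integral>\<^sup>+v. ennreal ((norm (step n y v - z))\<^sup>2) \<partial>distr P noise (Z (Suc n)))
        \<le> ennreal ((1 + a * (l n)\<^sup>2) * (norm (y - z))\<^sup>2 + a * (l n)\<^sup>2 - U n y)"
    and "\<And>n y. 2 * weight 0 * (l n * (objective \<mu> f y - objective \<mu> f z + (K + 1) * total_dist y))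
        \<le> U n y + (l n)\<^sup>2 * ((\<integral>s. (C s)\<^sup>2 \<partial>\<mu>) * (1 + norm y ^ p)\<^sup>2)"
proof -
  have z: "z \<in> (\<Inter>i\<in>{1..m}. X i)"
    and min: "\<And>y. y \<in> (\<Inter>i\<in>{1..m}. X i) \<Longrightarrow> objective \<mu> f z \<le> objective \<mu> f y"
    using sol by (auto simp: is_solution_def is_arg_min_linorder)
  have "convex_on UNIV (objective \<mu> f)"
    using convex_on_integral[OF f_int normal_convex_integrandD(2)[OF f_normal]]
    by (simp add: objective_def[abs_def])
  from exact_penalty[OF this m X regular z min]
  obtain K where K: "K \<ge> 0" "\<And>y. objective \<mu> f y + K * total_dist y \<ge> objective \<mu> f z" by blast
  have dist_nonneg: "total_dist y \<ge> 0" for y by (intro sum_nonneg) (simp add: infdist_nonneg)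
  define k where "k = K + 1"
  have k: "k \<ge> 0" using K by (simp add: k_def)
  have "objective \<mu> f y + k * total_dist y \<ge> objective \<mu> f z" for y
    using K(2)[of y] dist_nonneg[of y] by (simp add: k_def algebra_simps)
  from mean_envelope_penalty[OF f_normal f_int growth C X z k this]
  obtain c where c: "c \<ge> 0" "\<And>h y. h > 0 \<Longrightarrow>
      mean_envelope \<mu> f h y - h * objective \<mu> f z + h * k * total_dist y \<ge> - c * h\<^sup>2 * (1 + norm (y - z))"
    by blast
  define U where "U n y = 2 * weight 0 * (mean_envelope \<mu> f (l n) y - l n * objective \<mu> f z
      + l n * k * total_dist y + c * (l n)\<^sup>2 * (1 + norm (y - z)))" for n y
  define a where "a = (\<Sum>i=1..m. k\<^sup>2 / weight i) + 4 * c"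
  have w0: "0 < weight 0" "weight 0 \<le> 1" using weight_pos[of 0] weight_le_1[of 0] by auto
  have sum_nn: "(\<Sum>i=1..m. k\<^sup>2 / weight i) \<ge> 0"
    using weight_pos by (intro sum_nonneg divide_nonneg_pos) auto
  have a: "a \<ge> 0" using c sum_nn by (simp add: a_def)
  have U_nonneg: "U n y \<ge> 0" for n y
    unfolding U_def using c(2)[OF l_pos[of n], of y] w0 by (intro mult_nonneg_nonneg) auto
  have U_meas: "U n \<in> borel_measurable borel" for n
  proof (rule borel_measurable_continuous_onI)
    show "continuous_on UNIV (U n)"
      unfolding U_def[abs_def]
      by (intro continuous_intros continuous_on_convex_UNIV convex_mean_envelope[OF f_normal l_pos f_int growth C]
          continuous_on_infdist)
  qed
  let ?R = "\<lambda>n y. (norm (y - z))\<^sup>2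
      - 2 * weight 0 * (mean_envelope \<mu> f (l n) y - l n * objective \<mu> f z)
      - (\<Sum>i=1..m. weight i * (infdist y (X i))\<^sup>2)"
  have R_le: "?R n y \<le> (1 + a * (l n)\<^sup>2) * (norm (y - z))\<^sup>2 + a * (l n)\<^sup>2 - U n y" for n y
  proof -
    let ?t = "norm (y - z)" and ?h = "l n"
    have "2 * weight 0 * (?h * k * total_dist y) \<le> 2 * 1 * (?h * k * total_dist y)"
      using w0 k dist_nonneg[of y] l_pos[of n] by (intro mult_right_mono mult_nonneg_nonneg) auto
    moreover have "2 * (?h * k * total_dist y) - (\<Sum>i=1..m. weight i * (infdist y (X i))\<^sup>2)
        \<le> ?h\<^sup>2 * (\<Sum>i=1..m. k\<^sup>2 / weight i)"
      unfolding sum_distrib_left sum_subtractf[symmetric]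
    proof (rule sum_mono)
      fix i assume "i \<in> {1..m}"
      then have w: "weight i > 0" by (intro weight_pos) auto
      let ?d = "infdist y (X i)"
      \<comment> \<open>Complete the square in the distance.\<close>
      have "0 \<le> (?h * k - weight i * ?d)\<^sup>2 / weight i" using w by simp
      also have "\<dots> = ?h\<^sup>2 * (k\<^sup>2 / weight i) - (2 * (?h * k * ?d) - weight i * ?d\<^sup>2)"
        using w by (simp add: power2_eq_square field_simps)
      finally show "2 * (?h * k * ?d) - weight i * ?d\<^sup>2 \<le> ?h\<^sup>2 * (k\<^sup>2 / weight i)" by simp
    qed
    moreover have "2 * weight 0 * (c * ?h\<^sup>2 * (1 + ?t)) \<le> 4 * (c * ?h\<^sup>2 * (1 + ?t\<^sup>2))"
    proof -
      have "0 \<le> ?t\<^sup>2 + 1 - 2 * ?t" using zero_le_power2[of "?t - 1"] by (simp add: power2_diff)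
      then have "1 + ?t \<le> 2 * (1 + ?t\<^sup>2)" 
        using zero_le_power2[of ?t] by (simp only: distrib_left)
      then have "c * ?h\<^sup>2 * (1 + ?t) \<le> c * ?h\<^sup>2 * (2 * (1 + ?t\<^sup>2))" using c by (intro mult_left_mono) auto
      then have "2 * 1 * (c * ?h\<^sup>2 * (1 + ?t)) \<le> 4 * (c * ?h\<^sup>2 * (1 + ?t\<^sup>2))"
        by (simp add: algebra_simps)
      moreover have "2 * weight 0 * (c * ?h\<^sup>2 * (1 + ?t)) \<le> 2 * 1 * (c * ?h\<^sup>2 * (1 + ?t))"
        using w0 c by (intro mult_right_mono mult_nonneg_nonneg) auto
      ultimately show ?thesis by (rule order_trans[rotated])
    qed
    moreover have "?h\<^sup>2 * (\<Sum>i=1..m. k\<^sup>2 / weight i) + 4 * (c * ?h\<^sup>2 * (1 + ?t\<^sup>2)) \<le> a * ?h\<^sup>2 * ?t\<^sup>2 + a * ?h\<^sup>2"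
    proof -
      have "0 \<le> (\<Sum>i=1..m. k\<^sup>2 / weight i) * ?h\<^sup>2 * ?t\<^sup>2" using sum_nn by simp
      then show ?thesis by (simp add: a_def algebra_simps)
    qed
    moreover have "?R n y + U n y = ?t\<^sup>2 + 2 * weight 0 * (?h * k * total_dist y)
        - (\<Sum>i=1..m. weight i * (infdist y (X i))\<^sup>2) + 2 * weight 0 * (c * ?h\<^sup>2 * (1 + ?t))"
      by (simp add: U_def algebra_simps)
    moreover have "(1 + a * ?h\<^sup>2) * ?t\<^sup>2 + a * ?h\<^sup>2 = ?t\<^sup>2 + (a * ?h\<^sup>2 * ?t\<^sup>2 + a * ?h\<^sup>2)"
      by (simp add: algebra_simps)
    ultimately show ?thesis by linarith
  qed
  show thesis
  proof (rule that[OF K(1) a K(2) U_nonneg U_meas])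
    fix n y
    show "0 \<le> (1 + a * (l n)\<^sup>2) * (norm (y - z))\<^sup>2 + a * (l n)\<^sup>2 - U n y"
      by (rule order_trans[OF mean_step_le(1)[OF z] R_le])
    show "(\<integral>\<^sup>+v. ennreal ((norm (step n y v - z))\<^sup>2) \<partial>distr P noise (Z (Suc n)))
        \<le> ennreal ((1 + a * (l n)\<^sup>2) * (norm (y - z))\<^sup>2 + a * (l n)\<^sup>2 - U n y)"
      by (rule order_trans[OF mean_step_le(2)[OF z] ennreal_leI[OF R_le]])
    let ?e = "(\<integral>s. (C s)\<^sup>2 \<partial>\<mu>) * (1 + norm y ^ p)\<^sup>2"
    have e: "?e \<ge> 0" by (intro mult_nonneg_nonneg integral_nonneg_AE) auto
    have "l n * objective \<mu> f y \<le> mean_envelope \<mu> f (l n) y + (l n)\<^sup>2 / 2 * ?e"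
      using mean_envelope_ge[OF f_normal l_pos f_int growth C, of n y] by simp
    moreover have "0 \<le> c * (l n)\<^sup>2 * (1 + norm (y - z))" using c by simp
    ultimately have "l n * (objective \<mu> f y - objective \<mu> f z + k * total_dist y)
        \<le> (mean_envelope \<mu> f (l n) y - l n * objective \<mu> f z
          + l n * k * total_dist y + c * (l n)\<^sup>2 * (1 + norm (y - z))) + (l n)\<^sup>2 / 2 * ?e"
      by (simp add: algebra_simps)
    then have "2 * weight 0 * (l n * (objective \<mu> f y - objective \<mu> f z + k * total_dist y))
        \<le> 2 * weight 0 * ((mean_envelope \<mu> f (l n) y - l n * objective \<mu> f z
          + l n * k * total_dist y + c * (l n)\<^sup>2 * (1 + norm (y - z))) + (l n)\<^sup>2 / 2 * ?e)"
      using w0 by (intro mult_left_mono) auto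
    also have "\<dots> = U n y + weight 0 * ((l n)\<^sup>2 * ?e)" by (simp add: U_def algebra_simps)
    also have "\<dots> \<le> U n y + 1 * ((l n)\<^sup>2 * ?e)"
      using w0 e by (intro add_left_mono mult_right_mono) auto
    finally show "2 * weight 0 * (l n * (objective \<mu> f y - objective \<mu> f z + (K + 1) * total_dist y))
        \<le> U n y + (l n)\<^sup>2 * ?e" by (simp add: k_def)
  qed
qed

lemma past_subset: "sets (past n) \<subseteq> events"
  by (rule sets_history_subset) (rule Z_measurable)

lemma past_mono: "sets (past n) \<subseteq> sets (past (Suc n))"
  by (rule sets_history_mono) (rule Z_measurable)

lemma x_measurable [measurable]: "x n \<in> borel_measurable P"
  using measurable_mono[OF order_refl refl past_subset space_history] x_adapted by blast

text \<open>
  Integrating the pointwise bound over an event \<open>A\<close> of the past, with \<open>x n\<close> and the indicator of \<open>A\<close>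
  frozen, gives the drift inequality of the Robbins--Siegmund theorem.
\<close>

lemma distance_and_decrease_converge:
  assumes a: "a \<ge> 0" and U: "\<And>n y. U n y \<ge> 0" and U_meas: "\<And>n. U n \<in> borel_measurable borel"
    and nonneg: "\<And>n y. 0 \<le> (1 + a * (l n)\<^sup>2) * (norm (y - z))\<^sup>2 + a * (l n)\<^sup>2 - U n y"
    and decrease: "\<And>n y. (\<integral>\<^sup>+v. ennreal ((norm (step n y v - z))\<^sup>2) \<partial>distr P noise (Z (Suc n)))
        \<le> ennreal ((1 + a * (l n)\<^sup>2) * (norm (y - z))\<^sup>2 + a * (l n)\<^sup>2 - U n y)"
  shows "AE \<omega> in P. convergent (\<lambda>n. (norm (x n \<omega> - z))\<^sup>2)" and "AE \<omega> in P. summable (\<lambda>n. U n (x n \<omega>))"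
proof -
  note [measurable] = U_meas
  have drift: "(\<integral>\<^sup>+\<omega>. indicator A \<omega> * ennreal ((norm (x (Suc n) \<omega> - z))\<^sup>2) \<partial>P)
      + (\<integral>\<^sup>+\<omega>. indicator A \<omega> * ennreal (U n (x n \<omega>)) \<partial>P)
    \<le> (\<integral>\<^sup>+\<omega>. indicator A \<omega> * ennreal ((1 + a * (l n)\<^sup>2) * (norm (x n \<omega> - z))\<^sup>2 + a * (l n)\<^sup>2) \<partial>P)"
    if A: "A \<in> sets (past n)" for A n
  proof -
    have [measurable]: "A \<in> events" using A past_subset by blast
    define h where "h = (\<lambda>((y, t), v). ennreal t * ennreal ((norm (step n y v - z))\<^sup>2))"
    have "(\<lambda>w. step n (fst (fst w)) (snd w)) \<in> borel_measurable (((borel :: 'a measure) \<Otimes>\<^sub>M (borel :: real measure)) \<Otimes>\<^sub>M noise)"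
    proof -
      have "(\<lambda>w. (fst (fst w), snd w)) \<in> ((borel :: 'a measure) \<Otimes>\<^sub>M (borel :: real measure)) \<Otimes>\<^sub>M noise \<rightarrow>\<^sub>M borel \<Otimes>\<^sub>M noise"
        by simp
      from measurable_compose[OF this measurable_step[of n]] show ?thesis by simp
    qed
    then have h: "h \<in> borel_measurable ((borel \<Otimes>\<^sub>M borel) \<Otimes>\<^sub>M noise)"
      unfolding h_def case_prod_beta' by simp
    have G: "(\<lambda>\<omega>. (x n \<omega>, indicator A \<omega> :: real)) \<in> past n \<rightarrow>\<^sub>M borel \<Otimes>\<^sub>M borel"
      using x_adapted[of n] A by (intro measurable_Pair borel_measurable_indicator)
    have step_meas: "(\<lambda>v. step n y v) \<in> borel_measurable (distr P noise (Z (Suc n)))" for y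
      using measurable_compose[OF measurable_Pair1' measurable_step[of n], of y] by simp
    have "(\<integral>\<^sup>+\<omega>. indicator A \<omega> * ennreal ((norm (x (Suc n) \<omega> - z))\<^sup>2) \<partial>P)
        = (\<integral>\<^sup>+\<omega>. h ((x n \<omega>, indicator A \<omega>), Z (Suc n) \<omega>) \<partial>P)"
      unfolding h_def x_Suc by (intro nn_integral_cong) (simp add: indicator_def)
    also have "\<dots> = (\<integral>\<^sup>+\<omega>. (\<integral>\<^sup>+v. h ((x n \<omega>, indicator A \<omega>), v) \<partial>distr P noise (Z (Suc n))) \<partial>P)"
      by (rule nn_integral_freeze_history[OF Z_indep G h])
    also have "\<dots> \<le> (\<integral>\<^sup>+\<omega>. indicator A \<omega>
        * ennreal ((1 + a * (l n)\<^sup>2) * (norm (x n \<omega> - z))\<^sup>2 + a * (l n)\<^sup>2 - U n (x n \<omega>)) \<partial>P)"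
    proof (rule nn_integral_mono)
      fix \<omega>
      have "(\<integral>\<^sup>+v. h ((x n \<omega>, indicator A \<omega>), v) \<partial>distr P noise (Z (Suc n)))
          = indicator A \<omega> * (\<integral>\<^sup>+v. ennreal ((norm (step n (x n \<omega>) v - z))\<^sup>2) \<partial>distr P noise (Z (Suc n)))"
        unfolding h_def using step_meas[of "x n \<omega>"]
        by (simp add: nn_integral_cmult[symmetric] indicator_def)
      also have "\<dots> \<le> indicator A \<omega>
          * ennreal ((1 + a * (l n)\<^sup>2) * (norm (x n \<omega> - z))\<^sup>2 + a * (l n)\<^sup>2 - U n (x n \<omega>))"
        by (intro mult_left_mono decrease) simp
      finally show "(\<integral>\<^sup>+v. h ((x n \<omega>, indicator A \<omega>), v) \<partial>distr P noise (Z (Suc n))) \<le> \<dots>" .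
    qed
    finally have "(\<integral>\<^sup>+\<omega>. indicator A \<omega> * ennreal ((norm (x (Suc n) \<omega> - z))\<^sup>2) \<partial>P)
        + (\<integral>\<^sup>+\<omega>. indicator A \<omega> * ennreal (U n (x n \<omega>)) \<partial>P)
      \<le> (\<integral>\<^sup>+\<omega>. indicator A \<omega>
        * ennreal ((1 + a * (l n)\<^sup>2) * (norm (x n \<omega> - z))\<^sup>2 + a * (l n)\<^sup>2 - U n (x n \<omega>)) \<partial>P)
        + (\<integral>\<^sup>+\<omega>. indicator A \<omega> * ennreal (U n (x n \<omega>)) \<partial>P)"
      by (rule add_right_mono)
    also have "\<dots> = (\<integral>\<^sup>+\<omega>. indicator A \<omega>
        * ennreal ((1 + a * (l n)\<^sup>2) * (norm (x n \<omega> - z))\<^sup>2 + a * (l n)\<^sup>2 - U n (x n \<omega>))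
        + indicator A \<omega> * ennreal (U n (x n \<omega>)) \<partial>P)"
      by (rule nn_integral_add[symmetric]) measurable
    also have "\<dots> = (\<integral>\<^sup>+\<omega>. indicator A \<omega> * ennreal ((1 + a * (l n)\<^sup>2) * (norm (x n \<omega> - z))\<^sup>2 + a * (l n)\<^sup>2) \<partial>P)"
      using nonneg U by (intro nn_integral_cong) (simp add: distrib_left[symmetric] ennreal_plus[symmetric] del: ennreal_plus)
    finally show ?thesis .
  qed
  have adapted: "(\<lambda>\<omega>. (norm (x n \<omega> - z))\<^sup>2) \<in> borel_measurable (past n)" for n
    using x_adapted[of n] by measurable
  have coeff: "0 \<le> a * (l n)\<^sup>2" "summable (\<lambda>n. a * (l n)\<^sup>2)" for n
    using a l_square_sum by (auto intro: summable_mult)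
  have start: "integrable P (\<lambda>\<omega>. (norm (x 0 \<omega> - z))\<^sup>2)" by simp
  have UW: "(\<lambda>\<omega>. U n (x n \<omega>)) \<in> borel_measurable P" for n by measurable
  note RS = Robbins_Siegmund[where F = past and V = "\<lambda>n \<omega>. (norm (x n \<omega> - z))\<^sup>2"
      and W = "\<lambda>n \<omega>. U n (x n \<omega>)" and a = "\<lambda>n. a * (l n)\<^sup>2" and b = "\<lambda>n. a * (l n)\<^sup>2",
      OF space_history past_subset past_mono adapted UW start zero_le_power2 U coeff coeff drift]
  show "AE \<omega> in P. convergent (\<lambda>n. (norm (x n \<omega> - z))\<^sup>2)" "AE \<omega> in P. summable (\<lambda>n. U n (x n \<omega>))"
    by (rule RS; assumption)+
qed

section \<open>Almost sure convergence of the averages\<close>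

lemma l_sum_from_1: "filterlim (\<lambda>n. \<Sum>k=1..n. l k) at_top sequentially"
proof -
  have "(\<Sum>k=1..n. l k) = - l 0 + (\<Sum>k<Suc n. l k)" for n
    by (simp add: lessThan_Suc_atMost atMost_atLeast0 sum.atLeast_Suc_atMost)
  moreover have "filterlim (\<lambda>n. - l 0 + (\<Sum>k<Suc n. l k)) at_top sequentially"
    by (intro filterlim_tendsto_add_at_top[OF tendsto_const] filterlim_compose[OF l_sum filterlim_Suc])
  ultimately show ?thesis by simp
qed

text \<open>
  Along one trajectory with bounded iterates, the weighted sum of the penalised gaps is finite, so
  Jensen's inequality forces the gap of the averages to \<open>0\<close>.
\<close>

lemma cluster_point_is_solution:
  fixes y :: "nat \<Rightarrow> 'a"
  assumes sol: "is_solution \<mu> f m X z" and K: "K \<ge> 0"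
    and penalty: "\<And>y. objective \<mu> f y + K * total_dist y \<ge> objective \<mu> f z"
    and bdd: "\<And>n. norm (y n) \<le> B"
    and e: "summable e" "\<And>n. e n \<ge> 0"
    and gap: "\<And>n. 2 * weight 0 * (l n * (objective \<mu> f (y n) - objective \<mu> f z + (K + 1) * total_dist (y n)))
        \<le> e n + (l n)\<^sup>2 * ((\<integral>s. (C s)\<^sup>2 \<partial>\<mu>) * (1 + norm (y n) ^ p)\<^sup>2)"
    and r: "strict_mono r" and u: "(\<lambda>n. weighted_average l y (r n)) \<longlonglongrightarrow> u"
  shows "is_solution \<mu> f m X u"
proof -
  define G where "G y = objective \<mu> f y - objective \<mu> f z + (K + 1) * total_dist y" for y
  define I where "I = (\<integral>s. (C s)\<^sup>2 \<partial>\<mu>)"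
  have I: "I \<ge> 0" unfolding I_def by (rule integral_nonneg_AE) simp
  have w0: "weight 0 > 0" by (rule weight_pos) simp
  have F: "convex_on UNIV (objective \<mu> f)"
    using convex_on_integral[OF f_int normal_convex_integrandD(2)[OF f_normal]]
    by (simp add: objective_def[abs_def])
  have "convex_on UNIV (\<lambda>y. objective \<mu> f y + (- objective \<mu> f z) + (K + 1) * total_dist y)"
    using K X by (intro convex_on_add F convex_on_cmul convex_on_sum_fun convex_on_infdist iffD2[OF convex_on_const]) auto
  then have G: "convex_on UNIV G" by (simp add: G_def[abs_def])
  define s where "s n = (\<Sum>k=1..n. l k)" for n
  have s: "s n > 0" if "n \<ge> 1" for n unfolding s_def using l_pos that by (intro sum_pos) auto
  define b where "b n = e n + (l n)\<^sup>2 * (I * (1 + B ^ p)\<^sup>2)" for n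
  have b: "summable b" "\<And>n. b n \<ge> 0"
    unfolding b_def using e l_square_sum I by (auto intro!: summable_add summable_mult2)
  have "2 * weight 0 * (l n * G (y n)) \<le> b n" for n
  proof -
    have "(1 + norm (y n) ^ p)\<^sup>2 \<le> (1 + B ^ p)\<^sup>2"
      using bdd[of n] by (intro power_mono add_left_mono) auto
    then have "(l n)\<^sup>2 * (I * (1 + norm (y n) ^ p)\<^sup>2) \<le> (l n)\<^sup>2 * (I * (1 + B ^ p)\<^sup>2)"
      using I by (intro mult_left_mono) auto
    then show ?thesis using gap[of n] unfolding b_def G_def I_def by linarith
  qed
  then have sum_G: "2 * weight 0 * (\<Sum>k=1..n. l k * G (y k)) \<le> suminf b" for n
    unfolding sum_distrib_left
    by (intro order_trans[OF sum_mono sum_le_suminf[OF b(1)]]) (auto simp: b)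
  have "G (weighted_average l y n) \<le> (suminf b / (2 * weight 0)) / s n" if n: "n \<ge> 1" for n
  proof -
    have "G (weighted_average l y n) \<le> weighted_average l (\<lambda>k. G (y k)) n"
      by (rule weighted_average_Jensen[OF G l_pos n])
    also have "\<dots> = (\<Sum>k=1..n. l k * G (y k)) / s n"
      unfolding weighted_average_def s_def[symmetric] by (simp add: divide_inverse mult.commute)
    also have "\<dots> \<le> (suminf b / (2 * weight 0)) / s n"
      using sum_G[of n] w0 s[OF n] by (intro divide_right_mono) (auto simp: field_simps)
    finally show ?thesis .
  qed
  then have "\<forall>\<^sub>F n in sequentially. G (weighted_average l y (r n)) \<le> (suminf b / (2 * weight 0)) / s (r n)"
    using r by (intro eventually_sequentiallyI[of 1]) (meson order_trans strict_mono_imp_increasing)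
  moreover have "(\<lambda>n. (suminf b / (2 * weight 0)) / s (r n)) \<longlonglongrightarrow> 0"
    using filterlim_compose[OF l_sum_from_1 filterlim_subseq[OF r]] unfolding s_def
    by (intro real_tendsto_divide_at_top[OF tendsto_const])
  moreover have "(\<lambda>n. G (weighted_average l y (r n))) \<longlonglongrightarrow> G u"
    using continuous_on_tendsto_compose[OF continuous_on_convex_UNIV[OF G, of UNIV] u] by simp
  ultimately have "G u \<le> 0" by (intro tendsto_le[OF sequentially_bot, of _ 0 _ "G u"])
  have "total_dist u \<le> 0" using \<open>G u \<le> 0\<close> penalty[of u] by (simp add: G_def algebra_simps)
  moreover have "infdist u (X i) \<le> total_dist u" if "i \<in> {1..m}" for i
    using that by (intro member_le_sum) (auto simp: infdist_nonneg)
  ultimately have "infdist u (X i) = 0" if "i \<in> {1..m}" for i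
    using that infdist_nonneg[of u "X i"] by (meson antisym order_trans)
  then have uX: "u \<in> (\<Inter>i\<in>{1..m}. X i)"
    using X by (auto simp: in_closed_iff_infdist_zero)
  then have "total_dist u = 0" by simp
  then have "objective \<mu> f u \<le> objective \<mu> f z" using \<open>G u \<le> 0\<close> by (simp add: G_def)
  with uX sol show ?thesis by (fastforce simp: is_solution_def is_arg_min_linorder)
qed

theorem averages_converge:
  assumes ex: "\<exists>z. is_solution \<mu> f m X z"
  shows "AE \<omega> in P. \<exists>u. is_solution \<mu> f m X u \<and> weighted_average l (\<lambda>k. x k \<omega>) \<longlonglongrightarrow> u"
proof -
  let ?S = "{z. is_solution \<mu> f m X z}"
  have dist_conv: "AE \<omega> in P. convergent (\<lambda>n. (norm (x n \<omega> - z))\<^sup>2)" if z: "z \<in> ?S" for z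
  proof -
    from z have "is_solution \<mu> f m X z" by simp
    then show ?thesis
      by (rule mean_decrease) (rule distance_and_decrease_converge(1); assumption)
  qed
  obtain z where z: "is_solution \<mu> f m X z" using ex by blast
  show ?thesis
  proof (rule mean_decrease[OF z])
    fix K a :: real and U :: "nat \<Rightarrow> 'a \<Rightarrow> real"
    assume K: "K \<ge> 0" and a: "a \<ge> 0"
      and penalty: "\<And>y. objective \<mu> f y + K * total_dist y \<ge> objective \<mu> f z"
      and U: "\<And>n y. U n y \<ge> 0" "\<And>n. U n \<in> borel_measurable borel"
        "\<And>n y. 0 \<le> (1 + a * (l n)\<^sup>2) * (norm (y - z))\<^sup>2 + a * (l n)\<^sup>2 - U n y"
        "\<And>n y. (\<integral>\<^sup>+v. ennreal ((norm (step n y v - z))\<^sup>2) \<partial>distr P noise (Z (Suc n)))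
          \<le> ennreal ((1 + a * (l n)\<^sup>2) * (norm (y - z))\<^sup>2 + a * (l n)\<^sup>2 - U n y)"
      and gap: "\<And>n y. 2 * weight 0 * (l n * (objective \<mu> f y - objective \<mu> f z + (K + 1) * total_dist y))
          \<le> U n y + (l n)\<^sup>2 * ((\<integral>s. (C s)\<^sup>2 \<partial>\<mu>) * (1 + norm y ^ p)\<^sup>2)"
    note U_summable = distance_and_decrease_converge(2)[OF a U]
    \<comment> \<open>Finitely many differences of solutions span all of them, so one null set suffices.\<close>
    let ?D = "{u - v | u v. u \<in> ?S \<and> v \<in> ?S}"
    obtain B where B: "B \<subseteq> ?D" "independent B" "?D \<subseteq> span B"
      by (rule basis_exists[of ?D])
    have "finite B" using B(2) by (rule independent_imp_finite)
    have inner_conv: "AE \<omega> in P. convergent (\<lambda>n. inner (x n \<omega>) b)" if "b \<in> B" for b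
    proof -
      obtain u v where uv: "u \<in> ?S" "v \<in> ?S" "b = u - v" using \<open>b \<in> B\<close> B(1) by blast
      from dist_conv[OF uv(1)] dist_conv[OF uv(2)] show ?thesis
      proof eventually_elim
        case (elim \<omega>)
        have eq: "inner (x n \<omega>) b
            = ((norm (x n \<omega> - v))\<^sup>2 - (norm (x n \<omega> - u))\<^sup>2 + (norm u)\<^sup>2 - (norm v)\<^sup>2) / 2" for n
          unfolding power2_norm_eq_inner uv(3) by (simp add: inner_diff inner_commute)
        obtain Lu Lv where "(\<lambda>n. (norm (x n \<omega> - u))\<^sup>2) \<longlonglongrightarrow> Lu" "(\<lambda>n. (norm (x n \<omega> - v))\<^sup>2) \<longlonglongrightarrow> Lv"
          using elim by (auto simp: convergent_def)
        then have "(\<lambda>n. inner (x n \<omega>) b) \<longlonglongrightarrow> (Lv - Lu + (norm u)\<^sup>2 - (norm v)\<^sup>2) / 2"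
          unfolding eq by (intro tendsto_intros) auto
        then show ?case by (rule convergentI)
      qed
    qed
    have "AE \<omega> in P. \<forall>b\<in>B. convergent (\<lambda>n. inner (x n \<omega>) b)"
      using \<open>finite B\<close> inner_conv by (intro AE_finite_allI)
    moreover have "AE \<omega> in P. convergent (\<lambda>n. (norm (x n \<omega> - z))\<^sup>2)" using z by (intro dist_conv) simp
    ultimately show ?thesis using U_summable
    proof eventually_elim
      case (elim \<omega>)
      let ?y = "\<lambda>k. x k \<omega>"
      obtain c where c: "\<And>n. (norm (?y n - z))\<^sup>2 \<le> c"
        using convergent_imp_Bseq[OF elim(2)] unfolding Bseq_def by auto
      have y_le: "norm (?y n) \<le> norm z + sqrt c" for n
        using real_le_rsqrt[OF c[of n]] norm_triangle_sub[of "?y n" z] by linarith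
      have "norm (weighted_average l ?y n) \<le> norm z + sqrt c" for n
      proof (cases "n \<ge> 1")
        case True
        have cvx: "convex_on UNIV (norm :: 'a \<Rightarrow> real)"
          by (intro convex_onI norm_triangle_le) auto
        have "norm (weighted_average l ?y n) \<le> weighted_average l (\<lambda>k. norm (?y k)) n"
          by (rule weighted_average_Jensen[OF cvx l_pos True])
        also have "\<dots> \<le> weighted_average l (\<lambda>k. norm z + sqrt c) n"
          unfolding weighted_average_def real_scaleR_def
          using y_le l_pos by (intro mult_left_mono sum_mono) (auto simp: less_imp_le sum_nonneg)
        also have "\<dots> = norm z + sqrt c"
        proof -
          have "(\<Sum>k=1..n. l k) > 0" using l_pos True by (intro sum_pos) auto
          then show ?thesis
            unfolding weighted_average_def real_scaleR_def sum_distrib_right[symmetric] by simp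
        qed
        finally show ?thesis .
      next
        case False
        then show ?thesis using order_trans[OF norm_ge_zero y_le[of 0]] by (simp add: weighted_average_def)
      qed
      then have bdd: "bounded (range (weighted_average l ?y))" by (auto simp: bounded_iff)
      have "subspace {b. convergent (\<lambda>n. inner (?y n) b)}"
        unfolding subspace_def
        by (auto simp: inner_add_right convergent_const intro: convergent_add convergent_mult[OF convergent_const])
      then have "span B \<subseteq> {b. convergent (\<lambda>n. inner (?y n) b)}"
        using elim(1) by (intro span_minimal) auto
      then have inner: "convergent (\<lambda>n. inner (?y n) (u - v))" if "u \<in> ?S" "v \<in> ?S" for u v
        using that B(3) by blast
      have "\<exists>u\<in>?S. weighted_average l ?y \<longlonglongrightarrow> u"
      proof (rule weighted_average_converges_in[OF l_pos l_sum_from_1 bdd _ inner])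
        fix r u assume "strict_mono r" "(\<lambda>n. weighted_average l ?y (r n)) \<longlonglongrightarrow> u"
        then show "u \<in> ?S"
          using cluster_point_is_solution[OF z K penalty y_le elim(3) U(1) gap] by simp
      qed
      then show ?case by auto
    qed
  qed
qed

end

theorem theorem7:
  fixes \<mu> :: "'e measure"
    and P :: "'w measure"
    and f :: "'e \<Rightarrow> real ^ 'd \<Rightarrow> real"
    and m :: nat and X :: "nat \<Rightarrow> (real ^ 'd) set"
    and l :: "nat \<Rightarrow> real"
    and \<xi> :: "nat \<Rightarrow> 'w \<Rightarrow> 'e" and J :: "nat \<Rightarrow> 'w \<Rightarrow> nat"
    and p :: nat and xp :: "real ^ 'd" and C :: "'e \<Rightarrow> real"
    and x0 :: "real ^ 'd"
  assumes mu: "prob_space \<mu>" "complete_measure \<mu>"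
    and P: "prob_space P"
    and m: "m \<ge> 1"
    and X: "\<And>i. i \<in> {1..m} \<Longrightarrow> X i \<noteq> {} \<and> closed (X i) \<and> convex (X i)"
    and step_pos: "\<And>n. l n > 0"
    and step_sum: "filterlim (\<lambda>n. \<Sum>k<n. l k) at_top sequentially"
    and step_square_sum: "summable (\<lambda>n. (l n)\<^sup>2)"
    and xi_indep: "prob_space.indep_vars P (\<lambda>_. \<mu>) \<xi> {1..}"
    and xi_distr: "\<And>n. n \<ge> 1 \<Longrightarrow> distr P \<mu> (\<xi> n) = \<mu>"
    and feasible: "(\<Inter>i\<in>{1..m}. X i) \<noteq> {}"
    and regular: "boundedly_linearly_regular m X"
    and f_normal: "normal_convex_integrand \<mu> f"
    and f_integrable: "\<And>x. integrable \<mu> (\<lambda>s. f s x)"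
    and solution_exists: "\<exists>x. is_solution \<mu> f m X x"
    and solution_L2: "\<And>x. is_solution \<mu> f m X x \<Longrightarrow>
          in_Lp \<mu> 2 (\<lambda>s. set_norm (subdifferential (f s) x))"
    and p: "p \<ge> 1"
    and xp_solution: "is_solution \<mu> f m X xp"
    and xp_L2p: "in_Lp \<mu> (2 * p) (\<lambda>s. set_norm (subdifferential (f s) xp))"
    and C_nonneg: "\<And>s. s \<in> space \<mu> \<Longrightarrow> C s \<ge> 0"
    and C_L2: "in_Lp \<mu> 2 C"
    and growth: "\<And>x. AE s in \<mu>. norm (min_norm_subgradient (f s) x) \<le> C s * (1 + norm x ^ p)"
    and J_indep: "prob_space.indep_vars P (\<lambda>_. count_space {0..m}) J {1..}"
    and J_ident: "\<And>n. n \<ge> 1 \<Longrightarrow>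
          distr P (count_space {0..m}) (J n) = distr P (count_space {0..m}) (J 1)"
    and J_pos: "\<And>n i. n \<ge> 1 \<Longrightarrow> i \<in> {0..m} \<Longrightarrow> measure P {\<omega> \<in> space P. J n \<omega> = i} > 0"
    and J_xi_indep: "prob_space.indep_set P
          (sets (vimage_algebra (space P) (\<lambda>\<omega>. \<lambda>n\<in>{1..}. \<xi> n \<omega>)
                   (PiM {1..} (\<lambda>_. \<mu>))))
          (sets (vimage_algebra (space P) (\<lambda>\<omega>. \<lambda>n\<in>{1..}. J n \<omega>)
                   (PiM {1..} (\<lambda>_. count_space {0..m}))))"
    and step_ratio: "(\<lambda>n. l n / l (Suc n)) \<longlonglongrightarrow> 1"
  shows "AE \<omega> in P. \<exists>x. is_solution \<mu> f m X x \<and>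
           (\<lambda>n. weighted_average l (\<lambda>k. iterate f X l \<xi> J x0 k \<omega>) n) \<longlonglongrightarrow> x"
proof -
  interpret random_splitting P \<mu> f m X l \<xi> J p C x0
    by (intro random_splitting.intro random_splitting_axioms.intro;
        fact P mu(1) m X step_pos step_sum step_square_sum xi_indep xi_distr regular f_normal f_integrable
          C_L2 growth J_indep J_ident J_pos[OF order_refl] J_xi_indep)
  show ?thesis using averages_converge[OF solution_exists] by simp
qed

end
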